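(* If $N=2$ and $\mathbf A=\begin{pmatrix}1&1\\1&1\end{pmatrix}$, then there exists a real-valued $f\in V$ such that $\sum_{n\ge1}|\lambda_n(f)|=\infty$.
   Context: $\Sigma_{\mathbf A}^+=\{\omega\in\{1,\dots,N\}^{\mathbb N\cup\{0\}}:\mathbf A(\omega_m\omega_{m+1})=1\ \forall m\}$ with left shift $\sigma_{\mathbf A}$. $\mathrm{var}_m(\phi)=\sup\{|\phi(\omega)-\phi(\omega')|:\omega_k=\omega'_k,\ 0\le k\le m-1\}$; $V=\{\phi:\Sigma_{\mathbf A}^+\to\mathbb C:\mathrm{var}_m(\phi)^{1/m}\to0\}$. Transfer operator $(\mathscr L_f\phi)(\omega)=\sum_{\sigma_{\mathbf A}\omega'=\omega}e^{f(\omega')}\phi(\omega')$ acting on $V$; $\lambda_1(f),\lambda_2(f),\dots$ are its nonzero eigenvalues repeated with multiplicity, ordered by nonincreasing modulus (padded with zeros if finitely many). *)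

theory Defs
  imports "HOL-Analysis.Analysis" "HOL-Library.Extended_Nat"
begin

type_synonym word = "nat \<Rightarrow> nat"

definition SigmaA :: "nat \<Rightarrow> (nat \<Rightarrow> nat \<Rightarrow> nat) \<Rightarrow> word set" where
  "SigmaA N A = {\<omega>. (\<forall>m. \<omega> m \<in> {1..N}) \<and> (\<forall>m. A (\<omega> m) (\<omega> (Suc m)) = 1)}"

definition shiftA :: "word \<Rightarrow> word" where
  "shiftA \<omega> = (\<lambda>k. \<omega> (Suc k))"

text \<open>m-th variation (as an extended real, since the supremum may a priori be infinite).\<close>
definition varm :: "nat \<Rightarrow> (nat \<Rightarrow> nat \<Rightarrow> nat) \<Rightarrow> nat \<Rightarrow> (word \<Rightarrow> complex) \<Rightarrow> ereal" where
  "varm N A m \<phi> = (SUP p \<in> {(\<omega>, \<omega>'). \<omega> \<in> SigmaA N A \<and> \<omega>' \<in> SigmaA N A \<and> (\<forall>k<m. \<omega> k = \<omega>' k)}.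
                     ereal (cmod (\<phi> (fst p) - \<phi> (snd p))))"

text \<open>The space V; functions on Sigma_A are represented extensionally (value 0 off Sigma_A).\<close>
definition Vspace :: "nat \<Rightarrow> (nat \<Rightarrow> nat \<Rightarrow> nat) \<Rightarrow> (word \<Rightarrow> complex) set" where
  "Vspace N A = {\<phi>. (\<forall>\<omega>. \<omega> \<notin> SigmaA N A \<longrightarrow> \<phi> \<omega> = 0) \<and>
      (\<forall>\<^sub>F m in sequentially. varm N A m \<phi> \<noteq> \<infinity>) \<and>
      ((\<lambda>m. real_of_ereal (varm N A m \<phi>) powr (1 / real m)) \<longlonglongrightarrow> 0)}"

definition transfer :: "nat \<Rightarrow> (nat \<Rightarrow> nat \<Rightarrow> nat) \<Rightarrow> (word \<Rightarrow> complex) \<Rightarrow> (word \<Rightarrow> complex) \<Rightarrow> (word \<Rightarrow> complex)" where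
  "transfer N A f \<phi> = (\<lambda>\<omega>. if \<omega> \<in> SigmaA N A then
      (\<Sum>\<omega>' \<in> {\<omega>' \<in> SigmaA N A. shiftA \<omega>' = \<omega>}. exp (f \<omega>') * \<phi> \<omega>') else 0)"

definition lin_indep_C :: "(word \<Rightarrow> complex) set \<Rightarrow> bool" where
  "lin_indep_C S \<longleftrightarrow> finite S \<and>
     (\<forall>c. (\<lambda>\<omega>. \<Sum>s\<in>S. c s * s \<omega>) = (\<lambda>_. 0) \<longrightarrow> (\<forall>s\<in>S. c s = 0))"

definition gen_eigenspace :: "nat \<Rightarrow> (nat \<Rightarrow> nat \<Rightarrow> nat) \<Rightarrow> (word \<Rightarrow> complex) \<Rightarrow> complex \<Rightarrow> (word \<Rightarrow> complex) set" where
  "gen_eigenspace N A f \<mu> = {\<phi> \<in> Vspace N A.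
      \<exists>k. ((\<lambda>\<psi> \<omega>. transfer N A f \<psi> \<omega> - \<mu> * \<psi> \<omega>) ^^ k) \<phi> = (\<lambda>_. 0)}"

definition alg_mult :: "nat \<Rightarrow> (nat \<Rightarrow> nat \<Rightarrow> nat) \<Rightarrow> (word \<Rightarrow> complex) \<Rightarrow> complex \<Rightarrow> enat" where
  "alg_mult N A f \<mu> = (SUP S \<in> {S. S \<subseteq> gen_eigenspace N A f \<mu> \<and> lin_indep_C S}. enat (card S))"

text \<open>lam is the sequence lambda_1, lambda_2, ... (shifted to start at index 0): nonzero eigenvalues
  repeated with multiplicity, nonincreasing modulus, padded with zeros.\<close>
definition eigen_enumeration :: "nat \<Rightarrow> (nat \<Rightarrow> nat \<Rightarrow> nat) \<Rightarrow> (word \<Rightarrow> complex) \<Rightarrow> (nat \<Rightarrow> complex) \<Rightarrow> bool" where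
  "eigen_enumeration N A f lam \<longleftrightarrow>
     (\<forall>n. cmod (lam (Suc n)) \<le> cmod (lam n)) \<and>
     (\<forall>\<mu>. \<mu> \<noteq> 0 \<longrightarrow>
        (if finite {n. lam n = \<mu>} then enat (card {n. lam n = \<mu>}) else \<infinity>) = alg_mult N A f \<mu>)"

end

theory Submission
  imports Defs
begin

text \<open>
  Take a potential depending only on the number \<open>k\<close> of leading ones of a word, with
  \<open>exp f = g\<^sub>k\<close>, and put \<open>G\<^sub>k = g\<^sub>0 \<cdots> g\<^sub>k\<close>. Generalized eigenfunctions for nonzero eigenvalues
  also depend on \<open>k\<close> only, say \<open>\<phi> = h\<^sub>k\<close>. In terms of \<open>c\<^sub>0 = G\<^sub>0 h\<^sub>0\<close> and
  \<open>c\<^sub>k = G\<^sub>k h\<^sub>k - G\<^sub>k\<^sub>-\<^sub>1 h\<^sub>k\<^sub>-\<^sub>1\<close>, membership in \<open>V\<close> says that \<open>c\<close> decays superexponentially, and the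
  transfer operator becomes \<open>c \<mapsto> (c\<^sub>k\<^sub>+\<^sub>1 - p\<^sub>k\<^sub>+\<^sub>1 c\<^sub>0)\<^sub>k\<close>, where \<open>p\<close> can be prescribed almost freely
  through \<open>g\<close>. Passing to generating functions, \<open>\<mu> \<noteq> 0\<close> is an eigenvalue iff \<open>1/\<mu>\<close> is a zero of
  \<open>P z = 1 + p\<^sub>1 z + p\<^sub>2 z\<^sup>2 + \<dots>\<close>, and it is simple iff the zero is. The choice
  \<open>P z = 2 - exp (2 z)\<close> gives the simple eigenvalues \<open>2 / (ln 2 + 2 \<pi> \<i> m)\<close> with \<open>m\<close> an integer,
  whose moduli decay like \<open>1 / (\<pi> \<bar>m\<bar>)\<close>.
\<close>

section \<open>Superexponentially decaying sequences\<close>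

text \<open>Equivalent to \<open>|c k| ^ (1/k)\<close> tending to 0, that is, to the generating
  function of \<open>c\<close> being entire. A bound valid for all \<open>k\<close> with a constant
  combines more easily than an eventual root bound.\<close>

definition superexp_small :: "(nat \<Rightarrow> complex) \<Rightarrow> bool" where
  "superexp_small c \<longleftrightarrow> (\<forall>r>0. \<exists>K. \<forall>k. cmod (c k) \<le> K * r ^ k)"

lemma superexp_smallE:
  assumes "superexp_small c" "r > 0"
  obtains K where "K \<ge> 0" "\<And>k. cmod (c k) \<le> K * r ^ k"
proof -
  obtain K where K: "\<And>k. cmod (c k) \<le> K * r ^ k"
    using assms unfolding superexp_small_def by blast
  have "0 \<le> K" using order_trans[OF norm_ge_zero K[of 0]] by simp
  with K that show thesis by blast
qed

lemma superexp_small_add: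
  assumes "superexp_small c" "superexp_small d"
  shows "superexp_small (\<lambda>k. c k + d k)"
  unfolding superexp_small_def
proof (intro allI impI)
  fix r :: real assume r: "r > 0"
  obtain K where K: "\<And>k. cmod (c k) \<le> K * r ^ k" using superexp_smallE[OF assms(1) r] by blast
  obtain L where L: "\<And>k. cmod (d k) \<le> L * r ^ k" using superexp_smallE[OF assms(2) r] by blast
  have "cmod (c k + d k) \<le> (K + L) * r ^ k" for k
    using norm_triangle_ineq[of "c k" "d k"] K[of k] L[of k] by (simp add: algebra_simps)
  then show "\<exists>K. \<forall>k. cmod (c k + d k) \<le> K * r ^ k" by blast
qed

lemma superexp_small_bound:
  assumes "superexp_small c" "\<And>k. cmod (d k) \<le> B * cmod (c k)"
  shows "superexp_small d"
  unfolding superexp_small_def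
proof (intro allI impI)
  fix r :: real assume r: "r > 0"
  obtain K where K: "\<And>k. cmod (c k) \<le> K * r ^ k" using superexp_smallE[OF assms(1) r] by blast
  have "cmod (d k) \<le> (\<bar>B\<bar> * K) * r ^ k" for k
  proof -
    have "cmod (d k) \<le> \<bar>B\<bar> * cmod (c k)"
      using assms(2)[of k] mult_right_mono[OF abs_ge_self norm_ge_zero, of B "c k"] by linarith
    also have "\<dots> \<le> \<bar>B\<bar> * (K * r ^ k)" using K by (intro mult_left_mono) auto
    finally show ?thesis by (simp add: mult.assoc)
  qed
  then show "\<exists>K. \<forall>k. cmod (d k) \<le> K * r ^ k" by blast
qed

lemma superexp_small_cmult: "superexp_small c \<Longrightarrow> superexp_small (\<lambda>k. a * c k)"
  by (erule superexp_small_bound[where B = "cmod a"]) (simp add: norm_mult)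

lemma superexp_small_diff:
  assumes "superexp_small c" "superexp_small d"
  shows "superexp_small (\<lambda>k. c k - d k)"
  using superexp_small_add[OF assms(1) superexp_small_cmult[OF assms(2), of "-1"]] by simp

lemma superexp_small_Suc:
  assumes "superexp_small c"
  shows "superexp_small (\<lambda>k. c (Suc k))"
  unfolding superexp_small_def
proof (intro allI impI)
  fix r :: real assume r: "r > 0"
  obtain K where K: "\<And>k. cmod (c k) \<le> K * r ^ k" using superexp_smallE[OF assms(1) r] by blast
  have "cmod (c (Suc k)) \<le> (K * r) * r ^ k" for k
    using K[of "Suc k"] by (simp add: mult.assoc)
  then show "\<exists>K. \<forall>k. cmod (c (Suc k)) \<le> K * r ^ k" by blast
qed

lemma superexp_small_SucD:
  assumes "superexp_small (\<lambda>k. c (Suc k))"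
  shows "superexp_small c"
  unfolding superexp_small_def
proof (intro allI impI)
  fix r :: real assume r: "r > 0"
  obtain K where K: "K \<ge> 0" "\<And>k. cmod (c (Suc k)) \<le> K * r ^ k"
    using superexp_smallE[OF assms(1) r] by blast
  \<comment> \<open>The first summand covers index 0, and \<open>K / r\<close> pays for the index
    shift at positive \<open>k\<close>.\<close>
  have "cmod (c k) \<le> (cmod (c 0) + K / r) * r ^ k" for k
  proof (cases k)
    case 0
    then show ?thesis using K r by simp
  next
    case (Suc j)
    have "cmod (c (Suc j)) \<le> K * r ^ j" using K by simp
    also have "\<dots> = (K / r) * r ^ Suc j" using r by simp
    also have "\<dots> \<le> (cmod (c 0) + K / r) * r ^ Suc j" using r by (intro mult_right_mono) auto
    finally show ?thesis using Suc by simp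
  qed
  then show "\<exists>K. \<forall>k. cmod (c k) \<le> K * r ^ k" by blast
qed

lemma superexp_small_power_mult:
  assumes "superexp_small c"
  shows "superexp_small (\<lambda>k. w ^ k * c k)"
  unfolding superexp_small_def
proof (intro allI impI)
  fix r :: real assume r: "r > 0"
  \<comment> \<open>Decay at this smaller rate compensates the growth of \<open>w ^ k\<close>; the
    added 1 admits \<open>w = 0\<close>.\<close>
  define s where "s = r / (cmod w + 1)"
  have w: "cmod w + 1 > 0" using norm_ge_zero[of w] by linarith
  have s: "s > 0" using r w by (simp add: s_def)
  have ws: "cmod w * s \<le> r"
    using r w by (simp add: s_def divide_simps)
  obtain K where K: "K \<ge> 0" "\<And>k. cmod (c k) \<le> K * s ^ k"
    using superexp_smallE[OF assms(1) s] by blast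
  have "cmod (w ^ k * c k) \<le> K * r ^ k" for k
  proof -
    have "cmod (w ^ k * c k) \<le> cmod w ^ k * (K * s ^ k)"
      using K by (simp add: norm_mult norm_power mult_left_mono)
    also have "\<dots> = K * (cmod w * s) ^ k" by (simp add: power_mult_distrib)
    also have "\<dots> \<le> K * r ^ k" using K ws s by (intro mult_left_mono power_mono) auto
    finally show ?thesis .
  qed
  then show "\<exists>K. \<forall>k. cmod (w ^ k * c k) \<le> K * r ^ k" by blast
qed

lemma superexp_small_of_nat_mult:
  assumes "superexp_small c"
  shows "superexp_small (\<lambda>k. of_nat k * c k)"
proof (rule superexp_small_bound[OF superexp_small_power_mult[OF assms, of 2], where B = 1])
  fix k :: nat
  have "real k \<le> 2 ^ k" using of_nat_less_two_power[of k, where 'a = real] by linarith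
  then show "cmod (of_nat k * c k) \<le> 1 * cmod (2 ^ k * c k)"
    by (simp add: norm_mult norm_power mult_right_mono)
qed

lemma superexp_small_summable:
  assumes "superexp_small c"
  shows "summable c"
proof -
  obtain K where K: "\<And>k. cmod (c k) \<le> K * (1/2) ^ k"
    using superexp_smallE[OF assms, of "1/2"] by (metis half_gt_zero_iff zero_less_one)
  show ?thesis
    by (rule summable_comparison_test'[of "\<lambda>k. K * (1/2) ^ k" 0])
       (use K in \<open>auto intro!: summable_mult summable_geometric\<close>)
qed

lemma superexp_small_eventuallyI:
  assumes "\<And>r. r > 0 \<Longrightarrow> \<exists>M. \<forall>k\<ge>M. cmod (c k) \<le> r ^ k"
  shows "superexp_small c"
  unfolding superexp_small_def
proof (intro allI impI)
  fix r :: real assume r: "r > 0"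
  obtain M where M: "\<And>k. k \<ge> M \<Longrightarrow> cmod (c k) \<le> r ^ k" using assms[OF r] by blast
  \<comment> \<open>The sum absorbs the finitely many indices below \<open>M\<close>, the 1 handles
    all others.\<close>
  define K where "K = 1 + (\<Sum>k<M. cmod (c k) / r ^ k)"
  have "cmod (c k) \<le> K * r ^ k" for k
  proof (cases "k < M")
    case True
    have "cmod (c k) / r ^ k \<le> (\<Sum>k<M. cmod (c k) / r ^ k)"
      using True r by (intro member_le_sum) auto
    then have "cmod (c k) / r ^ k \<le> K" by (simp add: K_def)
    then show ?thesis using r by (simp add: divide_simps)
  next
    case False
    have "1 \<le> K" using r by (auto simp: K_def intro!: sum_nonneg)
    then have "1 * r ^ k \<le> K * r ^ k" using r by (intro mult_right_mono) auto
    then show ?thesis using M[of k] False by simp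
  qed
  then show "\<exists>K. \<forall>k. cmod (c k) \<le> K * r ^ k" by blast
qed

lemma superexp_small_LIMSEQ:
  assumes "superexp_small (\<lambda>k. h k - l)"
  shows "h \<longlonglongrightarrow> l"
  using summable_LIMSEQ_zero[OF superexp_small_summable[OF assms]] by (simp add: LIM_zero_iff)

text \<open>\<open>h k - l\<close> is minus the sum of all increments from index \<open>k\<close>
  on, and a geometric bound of ratio at most 1/2 makes that sum at most twice the bound on its first
  term.\<close>

lemma superexp_small_tail:
  assumes d: "superexp_small (\<lambda>k. h (Suc k) - h k)" and l: "h \<longlonglongrightarrow> l"
  shows "superexp_small (\<lambda>k. h k - l)"
  unfolding superexp_small_def
proof (intro allI impI)
  fix r0 :: real assume r0: "r0 > 0"
  define r where "r = min r0 (1/2)"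
  have r: "r > 0" "r \<le> 1/2" "r \<le> r0" using r0 by (auto simp: r_def)
  obtain K where K: "K \<ge> 0" "\<And>k. cmod (h (Suc k) - h k) \<le> K * r ^ k"
    using superexp_smallE[OF d r(1)] by blast
  have "cmod (h k - l) \<le> (2 * K) * r0 ^ k" for k
  proof -
    \<comment> \<open>The factor \<open>1 - (1/2) ^ n\<close> comes from the partial geometric sum;
      the bare bound \<open>2 * K * r ^ k\<close> would not survive the induction.\<close>
    have "cmod (h (k + n) - h k) \<le> 2 * K * r ^ k * (1 - (1/2) ^ n)" for n
    proof (induction n)
      case (Suc n)
      have "cmod (h (Suc (k + n)) - h (k + n)) \<le> K * r ^ k * r ^ n"
        using K(2)[of "k + n"] by (simp add: power_add mult.assoc)
      also have "\<dots> \<le> K * r ^ k * (1/2) ^ n"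
        using K r by (intro mult_left_mono power_mono) auto
      finally have "cmod (h (Suc (k + n)) - h (k + n)) \<le> K * r ^ k * (1/2) ^ n" .
      moreover have "cmod (h (Suc (k + n)) - h k)
          \<le> cmod (h (Suc (k + n)) - h (k + n)) + cmod (h (k + n) - h k)"
        using norm_triangle_ineq[of "h (Suc (k + n)) - h (k + n)" "h (k + n) - h k"] by simp
      ultimately show ?case using Suc.IH by (simp add: algebra_simps)
    qed simp
    moreover have "2 * K * r ^ k * (1 - (1/2) ^ n) \<le> 2 * K * r ^ k" for n
      using K r by (intro mult_left_le) auto
    ultimately have le: "cmod (h (k + n) - h k) \<le> 2 * K * r ^ k" for n
      by (rule order_trans)
    have "(\<lambda>n. h (k + n)) \<longlonglongrightarrow> l"
      using LIMSEQ_ignore_initial_segment[OF l, of k] by (simp add: add.commute)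
    then have "(\<lambda>n. cmod (h (k + n) - h k)) \<longlonglongrightarrow> cmod (l - h k)"
      by (intro tendsto_intros)
    then have "cmod (l - h k) \<le> 2 * K * r ^ k"
      by (rule LIMSEQ_le_const2) (use le in auto)
    also have "\<dots> \<le> 2 * K * r0 ^ k"
      using K r by (intro mult_left_mono power_mono) auto
    finally show ?thesis by (simp add: norm_minus_commute)
  qed
  then show "\<exists>K. \<forall>k. cmod (h k - l) \<le> K * r0 ^ k" by blast
qed

section \<open>Taylor coefficients of \<open>exp (2 z)\<close> and products of weights\<close>

definition coef :: "nat \<Rightarrow> real" where
  "coef j = 2 ^ j / fact j"

lemma coef_pos: "coef j > 0"
  by (simp add: coef_def)

lemma coef_sums: "(\<lambda>j. complex_of_real (coef j) * z ^ j) sums exp (2 * z)"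
proof -
  have "(2 * z) ^ j /\<^sub>R fact j = complex_of_real (coef j) * z ^ j" for j
    by (simp add: coef_def scaleR_conv_of_real field_simps)
  then show ?thesis using exp_converges[of "2 * z"] by simp
qed

text \<open>A single term of the positive series for \<open>exp (2 / r)\<close> is at most the whole
  sum, which serves as the constant at rate \<open>r\<close>.\<close>

lemma superexp_small_coef: "superexp_small (\<lambda>j. of_real (coef j))"
  unfolding superexp_small_def
proof (intro allI impI)
  fix r :: real assume r: "r > 0"
  have "coef j \<le> exp (2 / r) * r ^ j" for j
  proof -
    have sums: "(\<lambda>i. (2 / r) ^ i /\<^sub>R fact i) sums exp (2 / r)" by (rule exp_converges)
    have "(\<Sum>i\<in>{j}. (2 / r) ^ i /\<^sub>R fact i) \<le> exp (2 / r)"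
      unfolding sums_unique[OF sums]
      by (rule sum_le_suminf[OF sums_summable[OF sums]]) (use r in auto)
    then have "(2 / r) ^ j / fact j \<le> exp (2 / r)" by (simp add: field_simps)
    then have "(2 / r) ^ j / fact j * r ^ j \<le> exp (2 / r) * r ^ j"
      using r by (intro mult_right_mono) auto
    then show ?thesis using r by (simp add: coef_def power_divide)
  qed
  then show "\<exists>K. \<forall>k. cmod (complex_of_real (coef k)) \<le> K * r ^ k"
    by (auto simp: abs_of_pos coef_pos intro!: exI[of _ "exp (2 / r)"])
qed

text \<open>The product \<open>G\<^sub>k\<close> of the weights, the negated partial sum up to \<open>k + 1\<close> of the
  coefficients of \<open>2 - exp (2 z)\<close>.\<close>
definition wprod :: "nat \<Rightarrow> real" where
  "wprod k = (\<Sum>j\<le>Suc k. coef j) - 2"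

lemma wprod_0 [simp]: "wprod 0 = 1"
  by (simp add: wprod_def coef_def)

lemma wprod_Suc: "wprod (Suc k) = wprod k + coef (Suc (Suc k))"
  by (simp add: wprod_def)

text \<open>The sequence starts at \<open>1 + 2 - 2 = 1\<close> and increases. The bound makes
  division by \<open>wprod\<close> harmless for decay estimates and keeps the weights positive, so
  that their logarithms define a real potential.\<close>

lemma wprod_ge_1: "wprod k \<ge> 1"
proof (induction k)
  case (Suc k)
  then show ?case using coef_pos[of "Suc (Suc k)"] by (simp add: wprod_Suc)
qed simp

lemma wprod_nonzero [simp]: "wprod k \<noteq> 0"
  using wprod_ge_1[of k] by linarith

definition wlim :: real where
  "wlim = exp 2 - 2"

lemma wprod_lim: "wprod \<longlonglongrightarrow> wlim"
proof -
  have "coef sums exp 2"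
    using exp_converges[of "2::real"] by (simp add: coef_def[abs_def] divide_inverse mult.commute)
  then have "(\<lambda>n. \<Sum>j\<le>Suc n. coef j) \<longlonglongrightarrow> exp 2"
    using LIMSEQ_Suc[of "\<lambda>n. \<Sum>j\<le>n. coef j"] by (simp add: sums_def_le)
  then show ?thesis unfolding wprod_def wlim_def by (intro tendsto_intros)
qed

lemma wlim_ge_1: "wlim \<ge> 1"
  using wprod_lim by (rule LIMSEQ_le_const) (use wprod_ge_1 in auto)

lemma superexp_small_wprod: "superexp_small (\<lambda>k. of_real (wprod k) - of_real wlim)"
proof (rule superexp_small_tail)
  show "superexp_small (\<lambda>k. complex_of_real (wprod (Suc k)) - complex_of_real (wprod k))"
    using superexp_small_Suc[OF superexp_small_Suc[OF superexp_small_coef]] by (simp add: wprod_Suc)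
  show "(\<lambda>k. complex_of_real (wprod k)) \<longlonglongrightarrow> complex_of_real wlim"
    using wprod_lim by (rule tendsto_of_real)
qed

lemma wprod_le: "wprod k \<le> wlim"
  using wprod_lim
proof (rule incseq_le[rotated])
  show "incseq wprod"
    by (rule incseq_SucI) (use coef_pos less_imp_le in \<open>auto simp: wprod_Suc\<close>)
qed

section \<open>The operator on sequences and its generalized kernels\<close>

text \<open>The transfer operator in the coordinates \<open>c\<close> of the overview. The plus sign
  appears because the coefficients of \<open>2 - exp (2 z)\<close> at positive powers are
  \<open>- coef\<close>.\<close>

definition seq_op :: "(nat \<Rightarrow> complex) \<Rightarrow> nat \<Rightarrow> complex" where
  "seq_op c k = c (Suc k) + of_real (coef (Suc k)) * c 0"

lemma superexp_small_seq_op: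
  assumes "superexp_small c"
  shows "superexp_small (\<lambda>k. seq_op c k - \<mu> * c k)"
proof -
  have "superexp_small (\<lambda>k. (c (Suc k) + c 0 * of_real (coef (Suc k))) - \<mu> * c k)"
    by (intro superexp_small_diff superexp_small_add superexp_small_cmult
        superexp_small_Suc assms superexp_small_Suc[OF superexp_small_coef])
  then show ?thesis by (simp add: seq_op_def mult.commute)
qed

text \<open>The eigenvalue equation is a recurrence determined by \<open>c 0\<close>; this is its
  solution with \<open>c 0 = 1\<close>, namely \<open>\<mu> ^ k\<close> times a partial sum of
  \<open>2 - exp (2 z)\<close> at \<open>z = 1/\<mu>\<close>.\<close>

definition seq_eigvec :: "complex \<Rightarrow> nat \<Rightarrow> complex" where
  "seq_eigvec \<mu> k = \<mu> ^ k * (2 - (\<Sum>j\<le>k. of_real (coef j) * (1/\<mu>) ^ j))"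

lemma seq_eigvec_0 [simp]: "seq_eigvec \<mu> 0 = 1"
  by (simp add: seq_eigvec_def coef_def)

lemma seq_eigvec_Suc:
  assumes "\<mu> \<noteq> 0"
  shows "seq_eigvec \<mu> (Suc k) = \<mu> * seq_eigvec \<mu> k - of_real (coef (Suc k))"
  using assms by (simp add: seq_eigvec_def field_simps)

lemma seq_op_eigvec:
  assumes "\<mu> \<noteq> 0"
  shows "seq_op (seq_eigvec \<mu>) k = \<mu> * seq_eigvec \<mu> k"
  using assms by (simp add: seq_op_def seq_eigvec_Suc)

text \<open>When \<open>1/\<mu>\<close> is a zero of \<open>2 - exp (2 z)\<close>, the bracket in
  \<open>seq_eigvec\<close> is the remainder of the exponential series, whose superexponential decay
  outweighs \<open>\<mu> ^ k\<close>.\<close>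

lemma superexp_small_eigvec:
  assumes "\<mu> \<noteq> 0" "exp (2 / \<mu>) = 2"
  shows "superexp_small (seq_eigvec \<mu>)"
proof -
  let ?s = "\<lambda>k. \<Sum>j\<le>k. complex_of_real (coef j) * (1/\<mu>) ^ j"
  have "superexp_small (\<lambda>k. ?s k - 2)"
  proof (rule superexp_small_tail)
    show "superexp_small (\<lambda>k. ?s (Suc k) - ?s k)"
      using superexp_small_Suc[OF superexp_small_power_mult[OF superexp_small_coef, of "1/\<mu>"]]
      by (simp add: mult.commute)
    show "?s \<longlonglongrightarrow> 2"
      using coef_sums[of "1/\<mu>"] assms by (simp add: sums_def_le)
  qed
  then have "superexp_small (\<lambda>k. \<mu> ^ k * (-1 * (?s k - 2)))"
    by (intro superexp_small_power_mult superexp_small_cmult)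
  then show ?thesis by (simp add: seq_eigvec_def[abs_def])
qed

text \<open>Let \<open>C\<close> be the generating function of \<open>c\<close> and
  \<open>z = 1/\<mu>\<close>. The shift contributes \<open>C z - c 0\<close>, the other term of
  \<open>seq_op\<close> contributes \<open>c 0 * (exp (2 z) - 1)\<close>, and
  \<open>\<mu> * c\<close> cancels \<open>C z\<close>. Hence an eigenvector with
  \<open>c 0 \<noteq> 0\<close> forces \<open>exp (2 z) = 2\<close>, and at such \<open>z\<close>
  the pairing annihilates the range of the shifted operator.\<close>

lemma seq_op_pairing:
  assumes c: "superexp_small c" and "\<mu> \<noteq> 0"
  shows "(\<lambda>k. (seq_op c k - \<mu> * c k) * (1/\<mu>) ^ Suc k) sums (c 0 * (exp (2 / \<mu>) - 2))"
proof -
  let ?z = "1/\<mu>"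
  have cz: "(\<lambda>k. ?z ^ k * c k) sums (\<Sum>k. ?z ^ k * c k)"
    using superexp_small_summable[OF superexp_small_power_mult[OF c]] by blast
  have a: "(\<lambda>k. ?z ^ Suc k * c (Suc k)) sums ((\<Sum>k. ?z ^ k * c k) - c 0)"
    using sums_split_initial_segment[OF cz, of 1] by simp
  have b: "(\<lambda>k. of_real (coef (Suc k)) * ?z ^ Suc k) sums (exp (2 / \<mu>) - 1)"
    using sums_split_initial_segment[OF coef_sums[of ?z], of 1] by (simp add: coef_def)
  have "(\<lambda>k. ?z ^ Suc k * c (Suc k) + c 0 * (of_real (coef (Suc k)) * ?z ^ Suc k) - ?z ^ k * c k)
      sums ((\<Sum>k. ?z ^ k * c k) - c 0 + c 0 * (exp (2 / \<mu>) - 1) - (\<Sum>k. ?z ^ k * c k))"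
    by (intro sums_diff sums_add sums_mult a b cz)
  then show ?thesis
    using \<open>\<mu> \<noteq> 0\<close> by (simp add: seq_op_def algebra_simps)
qed

text \<open>Pairing the eigenvalue equation with \<open>(k + 1) \<mu>\<^sup>-\<^sup>k\<^sup>-\<^sup>1\<close>, that is, differentiating the
  generating function, computes the sum; it is nonzero because \<open>1/\<mu>\<close> is a simple zero of
  \<open>2 - exp (2 z)\<close>.\<close>
lemma seq_eigvec_sum:
  assumes "\<mu> \<noteq> 0" "exp (2 / \<mu>) = 2"
  shows "(\<lambda>k. seq_eigvec \<mu> k * (1/\<mu>) ^ k) sums (4 / \<mu>)"
proof -
  let ?z = "1/\<mu>" and ?e = "seq_eigvec \<mu>"
  have e: "superexp_small (\<lambda>k. ?z ^ k * ?e k)"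
    by (intro superexp_small_power_mult superexp_small_eigvec assms)
  define S where "S = (\<Sum>k. of_nat k * (?z ^ k * ?e k))"
  have S: "(\<lambda>k. of_nat k * (?z ^ k * ?e k)) sums S"
    using superexp_small_summable[OF superexp_small_of_nat_mult[OF e]] unfolding S_def by blast
  then have S': "(\<lambda>k. of_nat (Suc k) * (?z ^ Suc k * ?e (Suc k))) sums S"
    using sums_split_initial_segment[OF S, of 1] by simp
  have b: "(\<lambda>k. 2 * ?z * (of_real (coef k) * ?z ^ k)) sums (4 / \<mu>)"
    using sums_mult[OF coef_sums[of ?z], of "2 * ?z"] assms by simp
  have fact: "coef (Suc k) * real (Suc k) = 2 * coef k" for k
    by (simp add: coef_def divide_simps)
  \<comment> \<open>\<open>S\<close> enters with both signs and cancels. Dropping index 0 leaves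
    \<open>S\<close> unchanged, as that term carries the factor 0.\<close>
  have "(\<lambda>k. of_nat (Suc k) * (?z ^ Suc k * ?e (Suc k)) + 2 * ?z * (of_real (coef k) * ?z ^ k)
      - of_nat k * (?z ^ k * ?e k)) sums (S + 4 / \<mu> - S)"
    by (intro sums_diff sums_add S S' b)
  moreover have "of_nat (Suc k) * (?z ^ Suc k * ?e (Suc k)) + 2 * ?z * (of_real (coef k) * ?z ^ k)
      - of_nat k * (?z ^ k * ?e k) = ?e k * ?z ^ k" for k
  proof -
    have f: "2 * complex_of_real (coef k) = of_nat (Suc k) * of_real (coef (Suc k))"
      using arg_cong[OF fact[of k], of complex_of_real] by (simp add: mult.commute)
    have "of_nat (Suc k) * (?z ^ Suc k * ?e (Suc k)) + 2 * ?z * (of_real (coef k) * ?z ^ k)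
      = of_nat (Suc k) * ?z ^ Suc k * ?e (Suc k) + ?z ^ Suc k * (2 * of_real (coef k))"
      by (simp add: algebra_simps)
    also have "\<dots> = of_nat (Suc k) * ?z ^ Suc k * (?e (Suc k) + of_real (coef (Suc k)))"
      unfolding f by (simp only: algebra_simps)
    also have "\<dots> = of_nat (Suc k) * (?z ^ k * ?e k)"
      using assms by (simp add: seq_eigvec_Suc)
    finally show ?thesis by (simp add: algebra_simps)
  qed
  ultimately show ?thesis by simp
qed

text \<open>The recurrence determines \<open>c\<close> from \<open>c 0\<close>, and the pairing
  turns the eigenvalue equation into \<open>c 0 * (exp (2 / \<mu>) - 2) = 0\<close>.\<close>

lemma seq_op_kernel:
  assumes "\<mu> \<noteq> 0" "superexp_small c" "\<And>k. seq_op c k = \<mu> * c k"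
  shows "c = (\<lambda>k. c 0 * seq_eigvec \<mu> k)" "c 0 \<noteq> 0 \<Longrightarrow> exp (2 / \<mu>) = 2"
proof -
  show "c = (\<lambda>k. c 0 * seq_eigvec \<mu> k)"
  proof
    show "c k = c 0 * seq_eigvec \<mu> k" for k
    proof (induction k)
      case (Suc k)
      have "c (Suc k) = \<mu> * c k - of_real (coef (Suc k)) * c 0"
        using assms(3)[of k] by (simp add: seq_op_def algebra_simps)
      then show ?case using Suc assms(1) by (simp add: seq_eigvec_Suc algebra_simps)
    qed simp
  qed
  have "(\<lambda>k. 0) sums (c 0 * (exp (2 / \<mu>) - 2))"
    using seq_op_pairing[OF assms(2,1)] assms(3) by simp
  then have "c 0 * (exp (2 / \<mu>) - 2) = 0"
    using sums_unique2[OF _ sums_zero] by blast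
  then show "exp (2 / \<mu>) = 2" if "c 0 \<noteq> 0" using that by simp
qed

text \<open>There are no Jordan chains. By induction the image \<open>d\<close> of \<open>c\<close>
  under the shifted operator is a multiple of \<open>seq_eigvec \<mu>\<close>. If the multiple were
  nonzero, the pairing would annihilate \<open>d\<close> as an element of the range, but it does not
  annihilate the eigenvector, by \<open>seq_eigvec_sum\<close>.\<close>

lemma seq_op_gen_kernel:
  assumes "\<mu> \<noteq> 0" "superexp_small c"
    "((\<lambda>c k. seq_op c k - \<mu> * c k) ^^ n) c = (\<lambda>_. 0)"
  shows "\<forall>k. seq_op c k = \<mu> * c k"
  using assms(2,3)
proof (induction n arbitrary: c)
  case 0
  then show ?case by (simp add: seq_op_def)
next
  case (Suc n)
  define d where "d = (\<lambda>k. seq_op c k - \<mu> * c k)"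
  have d: "superexp_small d"
    unfolding d_def by (rule superexp_small_seq_op[OF Suc.prems(1)])
  have "((\<lambda>c k. seq_op c k - \<mu> * c k) ^^ n) d = (\<lambda>_. 0)"
    using Suc.prems(2) by (simp add: funpow_Suc_right d_def del: funpow.simps)
  then have dk: "\<forall>k. seq_op d k = \<mu> * d k" by (rule Suc.IH[OF d])
  note ker = seq_op_kernel[OF assms(1) d]
  have "d 0 = 0"
  proof (rule ccontr)
    assume "d 0 \<noteq> 0"
    then have ex: "exp (2 / \<mu>) = 2" using ker dk by blast
    have "d k = d 0 * seq_eigvec \<mu> k" for k using ker(1) dk by metis
    then have "d k * (1/\<mu>) ^ Suc k = d 0 * (1/\<mu>) * (seq_eigvec \<mu> k * (1/\<mu>) ^ k)" for k
      by (metis mult.assoc mult.left_commute power_Suc)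
    then have "(\<lambda>k. d k * (1/\<mu>) ^ Suc k) sums (d 0 * (1/\<mu>) * (4 / \<mu>))"
      using sums_mult[OF seq_eigvec_sum[OF assms(1) ex], of "d 0 * (1/\<mu>)"] by presburger
    moreover have "(\<lambda>k. d k * (1/\<mu>) ^ Suc k) sums 0"
      using seq_op_pairing[OF Suc.prems(1) assms(1)] ex by (simp add: d_def)
    ultimately have "d 0 * (1/\<mu>) * (4 / \<mu>) = 0" using sums_unique2 by blast
    then show False using \<open>d 0 \<noteq> 0\<close> assms(1) by simp
  qed
  then have "d k = 0" for k using ker(1) dk by (metis mult_zero_left)
  then show ?case by (simp add: d_def)
qed

section \<open>The full shift on two symbols and membership in \<open>V\<close>\<close>

definition full_shift :: "word set" where
  "full_shift = SigmaA 2 (\<lambda>_ _. 1)"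

lemma full_shift_iff: "\<omega> \<in> full_shift \<longleftrightarrow> (\<forall>m. \<omega> m = 1 \<or> \<omega> m = 2)"
proof -
  have "{1..2::nat} = {1, 2}" by auto
  then show ?thesis by (auto simp: full_shift_def SigmaA_def)
qed

text \<open>A bound on \<open>varm\<close> in real terms, so that later estimates avoid suprema of
  extended reals.\<close>

definition osc_small :: "(word \<Rightarrow> complex) \<Rightarrow> nat \<Rightarrow> real \<Rightarrow> bool" where
  "osc_small \<phi> m B \<longleftrightarrow> (\<forall>\<omega>\<in>full_shift. \<forall>\<omega>'\<in>full_shift.
     (\<forall>k<m. \<omega> k = \<omega>' k) \<longrightarrow> cmod (\<phi> \<omega> - \<phi> \<omega>') \<le> B)"

lemma varm_le_iff: "varm 2 (\<lambda>_ _. 1) m \<phi> \<le> ereal B \<longleftrightarrow> osc_small \<phi> m B"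
  by (auto simp: varm_def SUP_le_iff full_shift_def osc_small_def)

lemma varm_nonneg: "0 \<le> varm 2 (\<lambda>_ _. 1) m \<phi>"
proof -
  have "(\<lambda>_. 1) \<in> full_shift" by (simp add: full_shift_iff)
  then show ?thesis
    unfolding varm_def full_shift_def by (intro SUP_upper2[of "(\<lambda>_. 1, \<lambda>_. 1)"]) auto
qed

lemma Vspace_osc:
  assumes "\<phi> \<in> Vspace 2 (\<lambda>_ _. 1)" "r > 0"
  shows "\<exists>M. \<forall>m\<ge>M. osc_small \<phi> m (r ^ m)"
proof -
  let ?v = "\<lambda>m. varm 2 (\<lambda>_ _. 1) m \<phi>"
  have fin: "\<forall>\<^sub>F m in sequentially. ?v m \<noteq> \<infinity>"
    and lim: "(\<lambda>m. real_of_ereal (?v m) powr (1 / real m)) \<longlonglongrightarrow> 0"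
    using assms(1) by (auto simp: Vspace_def)
  have "\<forall>\<^sub>F m in sequentially. real_of_ereal (?v m) powr (1 / real m) < r"
    using order_tendstoD(2)[OF lim assms(2)] .
  \<comment> \<open>Index 0 is excluded because \<open>1 / real 0 = 0\<close> would turn the root
    into a zeroth power.\<close>
  with fin eventually_gt_at_top[of 0] have "eventually (\<lambda>m. osc_small \<phi> m (r ^ m)) sequentially"
  proof eventually_elim
    case (elim m)
    obtain x where x: "?v m = ereal x" "0 \<le> x"
      using elim(1) varm_nonneg[of m \<phi>] by (cases "?v m") auto
    have "(x powr (1 / real m)) powr real m \<le> r powr real m"
      using elim x by (intro powr_mono2) auto
    then have "x \<le> r ^ m"
      using x elim assms(2) by (simp add: powr_powr powr_realpow)
    then show ?case using x varm_le_iff[of m \<phi> "r ^ m"] by simp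
  qed
  then show ?thesis by (simp add: eventually_sequentially)
qed

text \<open>A constant factor \<open>K\<close> is harmless, since its \<open>m\<close>-th root tends
  to 1 when \<open>K > 0\<close>.\<close>

lemma VspaceI:
  assumes "\<And>\<omega>. \<omega> \<notin> full_shift \<Longrightarrow> \<phi> \<omega> = 0"
    and osc: "\<And>r. r > 0 \<Longrightarrow> \<exists>K. \<forall>m. osc_small \<phi> m (K * r ^ m)"
  shows "\<phi> \<in> Vspace 2 (\<lambda>_ _. 1)"
proof -
  let ?v = "\<lambda>m. varm 2 (\<lambda>_ _. 1) m \<phi>"
  have fin: "?v m \<noteq> \<infinity>" for m
  proof -
    obtain K :: real where "osc_small \<phi> m (K * 1 ^ m)" using osc[OF zero_less_one] by blast
    then have "?v m \<le> ereal (K * 1 ^ m)" by (simp only: varm_le_iff)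
    then show ?thesis by auto
  qed
  have "(\<lambda>m. real_of_ereal (?v m) powr (1 / real m)) \<longlonglongrightarrow> 0"
  proof (rule tendstoI)
    fix e :: real assume e: "e > 0"
    \<comment> \<open>At rate \<open>e/4\<close> a spare factor \<open>(1/2) ^ m\<close> eventually
      absorbs \<open>K\<close>, leaving \<open>(e/2) ^ m\<close>, whose root is strictly below
      \<open>e\<close>.\<close>
    obtain K where K: "\<And>m. osc_small \<phi> m (K * (e/4) ^ m)" using osc[of "e/4"] e by auto
    have "\<forall>\<^sub>F m in sequentially. norm (K * (1/2) ^ m) < 1"
    proof -
      have "(\<lambda>m. norm (K * (1/2) ^ m)) \<longlonglongrightarrow> norm (K * 0)"
        by (intro tendsto_intros LIMSEQ_power_zero) auto
      then show ?thesis by (rule order_tendstoD(2)) simp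
    qed
    then show "\<forall>\<^sub>F m in sequentially. dist (real_of_ereal (?v m) powr (1 / real m)) 0 < e"
      using eventually_gt_at_top[of 0]
    proof eventually_elim
      case (elim m)
      obtain x where x: "?v m = ereal x" "0 \<le> x"
        using fin[of m] varm_nonneg[of m \<phi>] by (cases "?v m") auto
      have "?v m \<le> ereal (K * (e/4) ^ m)" using K by (simp only: varm_le_iff)
      then have "x \<le> K * (e/4) ^ m" using x by simp
      also have "\<dots> = (K * (1/2) ^ m) * (e/2) ^ m"
        by (simp add: power_mult_distrib[symmetric] mult.assoc)
      also have "\<dots> \<le> 1 * (e/2) ^ m"
        using elim e by (intro mult_right_mono) auto
      finally have "x \<le> (e/2) powr real m" using e by (simp add: powr_realpow)
      then have "x powr (1 / real m) \<le> ((e/2) powr real m) powr (1 / real m)"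
        using x by (intro powr_mono2) auto
      also have "\<dots> = e/2" using elim e by (simp add: powr_powr)
      finally show ?case using x e by simp
    qed
  qed
  then show ?thesis using assms(1) fin by (auto simp: Vspace_def full_shift_def)
qed

section \<open>The number of leading ones and functions depending on it alone\<close>

definition lead :: "word \<Rightarrow> enat" where
  "lead \<omega> = (if \<forall>m. \<omega> m = 1 then \<infinity> else enat (LEAST m. \<omega> m \<noteq> 1))"

lemma lead_eq_enat: "lead \<omega> = enat k \<longleftrightarrow> (\<forall>j<k. \<omega> j = 1) \<and> \<omega> k \<noteq> 1"
proof
  assume *: "lead \<omega> = enat k"
  then have ex: "\<exists>m. \<omega> m \<noteq> 1" and k: "k = (LEAST m. \<omega> m \<noteq> 1)"
    by (auto simp: lead_def split: if_splits)
  show "(\<forall>j<k. \<omega> j = 1) \<and> \<omega> k \<noteq> 1"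
    using LeastI_ex[OF ex] not_less_Least[of _ "\<lambda>m. \<omega> m \<noteq> 1"] unfolding k by blast
next
  assume *: "(\<forall>j<k. \<omega> j = 1) \<and> \<omega> k \<noteq> 1"
  then have "(LEAST m. \<omega> m \<noteq> 1) = k"
    by (intro Least_equality) (auto simp: not_less[symmetric])
  then show "lead \<omega> = enat k" using * by (auto simp: lead_def)
qed

lemma lead_eq_infinity: "lead \<omega> = \<infinity> \<longleftrightarrow> (\<forall>m. \<omega> m = 1)"
  by (simp add: lead_def)

text \<open>A canonical representative of the words with exactly \<open>k\<close> leading ones;
  \<open>ones\<close> is the remaining class and the limit of the blocks.\<close>

definition block :: "nat \<Rightarrow> word" where
  "block k = (\<lambda>j. if j < k then 1 else 2)"

definition ones :: word where
  "ones = (\<lambda>_. 1)"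

lemma block_in [simp]: "block k \<in> full_shift"
  by (simp add: full_shift_iff block_def)

lemma ones_in [simp]: "ones \<in> full_shift"
  by (simp add: full_shift_iff ones_def)

lemma cons_in: "\<omega> \<in> full_shift \<Longrightarrow> i = 1 \<or> i = 2 \<Longrightarrow> case_nat i \<omega> \<in> full_shift"
  by (auto simp: full_shift_iff split: nat.split)

lemma lead_block [simp]: "lead (block k) = enat k"
  by (simp add: lead_eq_enat block_def)

lemma lead_ones [simp]: "lead ones = \<infinity>"
  by (simp add: lead_eq_infinity ones_def)

lemma lead_cons_2 [simp]: "lead (case_nat 2 \<omega>) = 0"
  by (simp add: lead_eq_enat zero_enat_def)

lemma lead_cons_1 [simp]: "lead (case_nat (Suc 0) \<omega>) = eSuc (lead \<omega>)"
proof (cases "lead \<omega>")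
  case (enat k)
  then have "lead (case_nat 1 \<omega>) = enat (Suc k)"
    by (auto simp: lead_eq_enat less_Suc_eq_0_disj split: nat.split)
  then show ?thesis using enat by (simp add: eSuc_enat)
next
  case infinity
  then have "lead (case_nat 1 \<omega>) = \<infinity>"
    by (auto simp: lead_eq_infinity split: nat.split)
  then show ?thesis using infinity by simp
qed

text \<open>A symbol other than 1 within the common prefix fixes both values of \<open>lead\<close>;
  otherwise both words begin with \<open>m\<close> ones.\<close>

lemma lead_agree:
  assumes "\<forall>k<m. \<omega> k = \<omega>' k"
  shows "lead \<omega> = lead \<omega>' \<or> (enat m \<le> lead \<omega> \<and> enat m \<le> lead \<omega>')"
proof -
  have *: "lead \<omega>' = lead \<omega>"
    if ag: "\<forall>k<m. \<omega> k = \<omega>' k" "\<not> enat m \<le> lead \<omega>" for \<omega> \<omega>' :: word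
  proof -
    obtain k where k: "lead \<omega> = enat k" "k < m"
      using ag by (cases "lead \<omega>") auto
    then have "lead \<omega>' = enat k" using ag by (simp add: lead_eq_enat)
    then show ?thesis using k by simp
  qed
  show ?thesis using *[of \<omega> \<omega>'] *[of \<omega>' \<omega>] assms by metis
qed

definition of_lead :: "(nat \<Rightarrow> complex) \<Rightarrow> complex \<Rightarrow> word \<Rightarrow> complex" where
  "of_lead h l \<omega> = (if \<omega> \<in> full_shift then (case lead \<omega> of enat k \<Rightarrow> h k | \<infinity> \<Rightarrow> l) else 0)"

text \<open>By \<open>lead_agree\<close>, words sharing \<open>m\<close> symbols either have equal
  values or both have values within \<open>K * r ^ m\<close> of \<open>l\<close>.\<close>

lemma of_lead_Vspace:
  assumes "superexp_small (\<lambda>k. h k - l)"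
  shows "of_lead h l \<in> Vspace 2 (\<lambda>_ _. 1)"
proof (rule VspaceI)
  fix r0 :: real assume r0: "r0 > 0"
  \<comment> \<open>With \<open>r \<le> 1\<close>, a bound at index
    \<open>lead \<omega> \<ge> m\<close> implies the bound at index \<open>m\<close>.\<close>
  define r where "r = min r0 1"
  have r: "r > 0" "r \<le> 1" "r \<le> r0" using r0 by (auto simp: r_def)
  obtain K where K: "K \<ge> 0" "\<And>k. cmod (h k - l) \<le> K * r ^ k"
    using superexp_smallE[OF assms r(1)] by blast
  have near: "cmod (of_lead h l \<omega> - l) \<le> K * r ^ m"
    if "\<omega> \<in> full_shift" "enat m \<le> lead \<omega>" for \<omega> m
  proof (cases "lead \<omega>")
    case (enat k)
    then have "cmod (of_lead h l \<omega> - l) \<le> K * r ^ k" using that K by (simp add: of_lead_def)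
    also have "\<dots> \<le> K * r ^ m"
      using that K r enat by (intro mult_left_mono power_decreasing) auto
    finally show ?thesis .
  next
    case infinity
    then show ?thesis using that K r by (simp add: of_lead_def)
  qed
  have "osc_small (of_lead h l) m (2 * K * r0 ^ m)" for m
    unfolding osc_small_def
  proof (intro ballI impI)
    fix \<omega> \<omega>' assume w: "\<omega> \<in> full_shift" "\<omega>' \<in> full_shift" "\<forall>k<m. \<omega> k = \<omega>' k"
    have "cmod (of_lead h l \<omega> - of_lead h l \<omega>') \<le> 2 * K * r ^ m"
    proof (cases "lead \<omega> = lead \<omega>'")
      case True
      then show ?thesis using w K r by (simp add: of_lead_def)
    next
      case False
      then have "enat m \<le> lead \<omega>" "enat m \<le> lead \<omega>'" using lead_agree[OF w(3)] by auto
      then show ?thesis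
        using norm_triangle_ineq4[of "of_lead h l \<omega> - l" "of_lead h l \<omega>' - l"]
          near[OF w(1)] near[OF w(2)] by fastforce
    qed
    also have "\<dots> \<le> 2 * K * r0 ^ m" using K r by (intro mult_left_mono power_mono) auto
    finally show "cmod (of_lead h l \<omega> - of_lead h l \<omega>') \<le> 2 * K * r0 ^ m" .
  qed
  then show "\<exists>K. \<forall>m. osc_small (of_lead h l) m (K * r0 ^ m)" by blast
qed (simp add: of_lead_def)

section \<open>The potential and its transfer operator\<close>

text \<open>The quotients make the product of the first \<open>k + 1\<close> weights telescope to
  \<open>wprod k\<close>.\<close>

definition weight :: "nat \<Rightarrow> real" where
  "weight k = (case k of 0 \<Rightarrow> 1 | Suc j \<Rightarrow> wprod (Suc j) / wprod j)"

lemma weight_simps [simp]: "weight 0 = 1" "weight (Suc j) = wprod (Suc j) / wprod j"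
  by (simp_all add: weight_def)

lemma weight_pos: "weight k > 0"
proof (cases k)
  case (Suc j)
  then show ?thesis using wprod_ge_1[of j] wprod_ge_1[of "Suc j"] by simp
qed simp

text \<open>A weight is \<open>1 + x\<close> with \<open>0 \<le> x \<le> coef (k + 2)\<close>, so
  the estimate \<open>ln (1 + x) \<le> x\<close> transfers the decay of \<open>coef\<close>.\<close>

lemma superexp_small_ln_weight: "superexp_small (\<lambda>k. of_real (ln (weight k)))"
proof (rule superexp_small_SucD)
  show "superexp_small (\<lambda>k. complex_of_real (ln (weight (Suc k))))"
  proof (rule superexp_small_bound[where B = 1])
    show "superexp_small (\<lambda>k. of_real (coef (Suc (Suc k))))"
      by (intro superexp_small_Suc superexp_small_coef)
    fix k
    have eq: "weight (Suc k) = 1 + coef (Suc (Suc k)) / wprod k"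
      by (simp add: wprod_Suc add_divide_distrib)
    have nn: "0 \<le> coef (Suc (Suc k)) / wprod k"
      using coef_pos[of "Suc (Suc k)"] wprod_ge_1[of k] by simp
    have "ln (weight (Suc k)) \<le> coef (Suc (Suc k)) / wprod k"
      unfolding eq using nn by (intro ln_add_one_self_le_self)
    also have "\<dots> \<le> coef (Suc (Suc k)) / 1"
      using coef_pos[of "Suc (Suc k)"] wprod_ge_1[of k] by (intro divide_left_mono) auto
    finally have "ln (weight (Suc k)) \<le> coef (Suc (Suc k))" by simp
    moreover have "0 \<le> ln (weight (Suc k))" unfolding eq using nn by (intro ln_ge_zero) simp
    ultimately show "cmod (complex_of_real (ln (weight (Suc k))))
        \<le> 1 * cmod (complex_of_real (coef (Suc (Suc k))))"
      by simp
  qed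
qed

text \<open>The value 0 at the all-ones word is the limit of \<open>ln (weight k)\<close>.\<close>

definition potential :: "word \<Rightarrow> complex" where
  "potential = of_lead (\<lambda>k. of_real (ln (weight k))) 0"

lemma potential_Vspace: "potential \<in> Vspace 2 (\<lambda>_ _. 1)"
  unfolding potential_def by (rule of_lead_Vspace) (simp add: superexp_small_ln_weight)

lemma exp_potential:
  "\<omega> \<in> full_shift \<Longrightarrow>
   exp (potential \<omega>) = (case lead \<omega> of enat k \<Rightarrow> of_real (weight k) | \<infinity> \<Rightarrow> 1)"
  by (auto simp: potential_def of_lead_def weight_pos exp_of_real split: enat.split)

definition transfer_op :: "(word \<Rightarrow> complex) \<Rightarrow> word \<Rightarrow> complex" where
  "transfer_op = transfer 2 (\<lambda>_ _. 1) potential"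

text \<open>The preimages are the two one-letter extensions: prefixing 1 raises \<open>lead\<close>
  by one, prefixing 2 resets it to 0, where the weight is 1.\<close>

lemma transfer_op_eq:
  assumes "\<omega> \<in> full_shift"
  shows "transfer_op \<phi> \<omega> =
    (case lead \<omega> of enat k \<Rightarrow> of_real (weight (Suc k)) | \<infinity> \<Rightarrow> 1) * \<phi> (case_nat 1 \<omega>)
    + \<phi> (case_nat 2 \<omega>)"
proof -
  have "{\<omega>' \<in> full_shift. shiftA \<omega>' = \<omega>} = {case_nat 1 \<omega>, case_nat 2 \<omega>}"
  proof (intro equalityI subsetI)
    fix \<omega>' assume "\<omega>' \<in> {\<omega>' \<in> full_shift. shiftA \<omega>' = \<omega>}"
    then have *: "\<omega>' \<in> full_shift" "\<omega> = (\<lambda>k. \<omega>' (Suc k))" by (auto simp: shiftA_def)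
    have "\<omega>' = case_nat (\<omega>' 0) \<omega>"
      by (rule ext) (simp add: * split: nat.split)
    moreover have "\<omega>' 0 = 1 \<or> \<omega>' 0 = 2" using *(1) by (simp add: full_shift_iff)
    ultimately show "\<omega>' \<in> {case_nat 1 \<omega>, case_nat 2 \<omega>}" by fastforce
  next
    fix \<omega>' assume "\<omega>' \<in> {case_nat 1 \<omega>, case_nat 2 \<omega>}"
    then show "\<omega>' \<in> {\<omega>' \<in> full_shift. shiftA \<omega>' = \<omega>}"
      using cons_in[OF assms, of 1] cons_in[OF assms, of 2] by (auto simp: shiftA_def)
  qed
  moreover have "(case_nat 1 \<omega> :: word) \<noteq> case_nat 2 \<omega>"
    by (auto dest: fun_cong[of _ _ 0])
  ultimately show ?thesis
    unfolding transfer_op_def transfer_def full_shift_def[symmetric]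
    using assms cons_in[OF assms, of 1] cons_in[OF assms, of 2]
    by (simp add: exp_potential zero_enat_def eSuc_enat split: enat.split)
qed

section \<open>Generalized eigenfunctions depend only on the number of leading ones\<close>

definition lead_osc :: "(word \<Rightarrow> complex) \<Rightarrow> nat \<Rightarrow> real \<Rightarrow> bool" where
  "lead_osc \<phi> m B \<longleftrightarrow> (\<forall>\<omega>\<in>full_shift. \<forall>\<omega>'\<in>full_shift.
     lead \<omega> = lead \<omega>' \<longrightarrow> (\<forall>k<m. \<omega> k = \<omega>' k) \<longrightarrow> cmod (\<phi> \<omega> - \<phi> \<omega>') \<le> B)"

text \<open>A consequence of membership in \<open>V\<close> that \<open>shifted_op\<close> visibly
  preserves; the induction in \<open>gen_kernel_lead_only\<close> runs on it.\<close>

definition lead_small :: "(word \<Rightarrow> complex) \<Rightarrow> bool" where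
  "lead_small \<phi> \<longleftrightarrow> (\<forall>r>0. \<exists>K M. \<forall>m\<ge>M. lead_osc \<phi> m (K * r ^ m))"

definition lead_only :: "(word \<Rightarrow> complex) \<Rightarrow> bool" where
  "lead_only \<phi> \<longleftrightarrow> (\<forall>\<omega>\<in>full_shift. \<forall>\<omega>'\<in>full_shift. lead \<omega> = lead \<omega>' \<longrightarrow> \<phi> \<omega> = \<phi> \<omega>')"

lemma lead_onlyD:
  "lead_only \<phi> \<Longrightarrow> \<omega> \<in> full_shift \<Longrightarrow> \<omega>' \<in> full_shift \<Longrightarrow> lead \<omega> = lead \<omega>' \<Longrightarrow> \<phi> \<omega> = \<phi> \<omega>'"
  unfolding lead_only_def by blast

definition shifted_op :: "complex \<Rightarrow> (word \<Rightarrow> complex) \<Rightarrow> word \<Rightarrow> complex" where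
  "shifted_op \<mu> \<phi> \<omega> = transfer_op \<phi> \<omega> - \<mu> * \<phi> \<omega>"

lemma Vspace_lead_small:
  assumes "\<phi> \<in> Vspace 2 (\<lambda>_ _. 1)"
  shows "lead_small \<phi>"
  unfolding lead_small_def
proof (intro allI impI)
  fix r :: real assume r: "r > 0"
  obtain M where "\<And>m. m \<ge> M \<Longrightarrow> osc_small \<phi> m (r ^ m)" using Vspace_osc[OF assms r] by blast
  then have "\<forall>m\<ge>M. lead_osc \<phi> m (1 * r ^ m)" by (simp add: lead_osc_def osc_small_def)
  then show "\<exists>K M. \<forall>m\<ge>M. lead_osc \<phi> m (K * r ^ m)" by blast
qed

lemma weight_le: "weight k \<le> wlim"
proof (cases k)
  case (Suc j)
  have "wprod (Suc j) / wprod j \<le> wprod (Suc j) / 1"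
    using wprod_ge_1[of j] wprod_ge_1[of "Suc j"] by (intro divide_left_mono) auto
  then show ?thesis using wprod_le[of "Suc j"] Suc by simp
qed (simp add: wlim_ge_1)

text \<open>Equal \<open>lead\<close> means equal weights at both words, so only differences of
  \<open>\<phi>\<close> remain. Prefixing a symbol gains one coordinate of agreement, and the two
  branches cost at most \<open>wlim\<close> and 1.\<close>

lemma transfer_op_osc:
  assumes "lead_osc \<phi> (Suc m) B" "\<omega> \<in> full_shift" "\<omega>' \<in> full_shift"
    "lead \<omega> = lead \<omega>'" "\<forall>k<m. \<omega> k = \<omega>' k"
  shows "cmod (transfer_op \<phi> \<omega> - transfer_op \<phi> \<omega>') \<le> (wlim + 1) * B"
proof -
  define W :: complex where
    "W = (case lead \<omega>' of enat k \<Rightarrow> of_real (weight (Suc k)) | \<infinity> \<Rightarrow> 1)"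
  have W: "cmod W \<le> wlim"
    using wlim_ge_1 weight_pos weight_le
    by (auto simp: W_def abs_of_pos simp del: weight_simps split: enat.split)
  have diff: "cmod (\<phi> (case_nat i \<omega>) - \<phi> (case_nat i \<omega>')) \<le> B" if "i = 1 \<or> i = 2" for i
  proof -
    have "lead (case_nat i \<omega>) = lead (case_nat i \<omega>')" using that assms(4) by auto
    moreover have "\<forall>k<Suc m. case_nat i \<omega> k = (case_nat i \<omega>' k :: nat)"
      using assms(5) by (auto split: nat.split)
    ultimately show ?thesis
      using assms(1) cons_in[OF assms(2) that] cons_in[OF assms(3) that]
      unfolding lead_osc_def by blast
  qed
  have eq: "transfer_op \<phi> \<omega> - transfer_op \<phi> \<omega>'
      = W * (\<phi> (case_nat 1 \<omega>) - \<phi> (case_nat 1 \<omega>')) + (\<phi> (case_nat 2 \<omega>) - \<phi> (case_nat 2 \<omega>'))"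
    unfolding transfer_op_eq[OF assms(2)] transfer_op_eq[OF assms(3)] assms(4) W_def[symmetric]
    by (simp add: algebra_simps)
  have "cmod (transfer_op \<phi> \<omega> - transfer_op \<phi> \<omega>') \<le> cmod W * cmod (\<phi> (case_nat 1 \<omega>) - \<phi> (case_nat 1 \<omega>'))
      + cmod (\<phi> (case_nat 2 \<omega>) - \<phi> (case_nat 2 \<omega>'))"
    unfolding eq norm_mult[symmetric] by (rule norm_triangle_ineq)
  also have "\<dots> \<le> wlim * B + B"
    using W diff[of 1] diff[of 2] wlim_ge_1 by (intro add_mono mult_mono) auto
  finally show ?thesis by (simp add: algebra_simps)
qed

lemma lead_small_shifted_op:
  assumes "lead_small \<phi>"
  shows "lead_small (shifted_op \<mu> \<phi>)"
  unfolding lead_small_def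
proof (intro allI impI)
  fix r :: real assume r: "r > 0"
  then obtain K M where KM: "\<And>m. m \<ge> M \<Longrightarrow> lead_osc \<phi> m (K * r ^ m)"
    using assms unfolding lead_small_def by blast
  have "lead_osc (shifted_op \<mu> \<phi>) m (((wlim + 1) * K * r + cmod \<mu> * K) * r ^ m)"
    if m: "m \<ge> M" for m
    unfolding lead_osc_def
  proof (intro ballI impI)
    fix \<omega> \<omega>' assume w: "\<omega> \<in> full_shift" "\<omega>' \<in> full_shift" "lead \<omega> = lead \<omega>'" "\<forall>k<m. \<omega> k = \<omega>' k"
    have 1: "cmod (transfer_op \<phi> \<omega> - transfer_op \<phi> \<omega>') \<le> (wlim + 1) * (K * r ^ Suc m)"
      using KM[of "Suc m"] m w by (intro transfer_op_osc) auto
    have "cmod (\<phi> \<omega> - \<phi> \<omega>') \<le> K * r ^ m" using KM[OF m] w by (simp add: lead_osc_def)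
    then have 2: "cmod \<mu> * cmod (\<phi> \<omega> - \<phi> \<omega>') \<le> cmod \<mu> * (K * r ^ m)"
      by (intro mult_left_mono) auto
    have eq: "shifted_op \<mu> \<phi> \<omega> - shifted_op \<mu> \<phi> \<omega>'
        = (transfer_op \<phi> \<omega> - transfer_op \<phi> \<omega>') - \<mu> * (\<phi> \<omega> - \<phi> \<omega>')"
      by (simp add: shifted_op_def algebra_simps)
    have "cmod (shifted_op \<mu> \<phi> \<omega> - shifted_op \<mu> \<phi> \<omega>')
        \<le> cmod (transfer_op \<phi> \<omega> - transfer_op \<phi> \<omega>') + cmod \<mu> * cmod (\<phi> \<omega> - \<phi> \<omega>')"
      unfolding eq norm_mult[symmetric] by (rule norm_triangle_ineq4)
    also have "\<dots> \<le> (wlim + 1) * (K * r ^ Suc m) + cmod \<mu> * (K * r ^ m)" using 1 2 by linarith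
    finally show "cmod (shifted_op \<mu> \<phi> \<omega> - shifted_op \<mu> \<phi> \<omega>')
        \<le> ((wlim + 1) * K * r + cmod \<mu> * K) * r ^ m"
      by (simp add: algebra_simps)
  qed
  then show "\<exists>K M. \<forall>m\<ge>M. lead_osc (shifted_op \<mu> \<phi>) m (K * r ^ m)" by blast
qed

text \<open>Words with the same number of leading ones carry equal weights, so inside such a class
  \<open>\<phi> = \<mu>\<^sup>-\<^sup>1 (transfer_op \<phi> - const)\<close> trades one more coordinate of agreement for a bounded
  factor, and the superexponential decay of the oscillation forces it to vanish.\<close>
lemma lead_only_if_shifted_op:
  assumes "\<mu> \<noteq> 0" "lead_small \<phi>" "lead_only (shifted_op \<mu> \<phi>)"
  shows "lead_only \<phi>"
proof -
  define D where "D = (wlim + 1) / cmod \<mu>"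
  have D: "D > 0" using assms(1) wlim_ge_1 by (simp add: D_def)
  have step: "lead_osc \<phi> m (D * B)" if "lead_osc \<phi> (Suc m) B" for m B
    unfolding lead_osc_def
  proof (intro ballI impI)
    fix \<omega> \<omega>' assume w: "\<omega> \<in> full_shift" "\<omega>' \<in> full_shift" "lead \<omega> = lead \<omega>'" "\<forall>k<m. \<omega> k = \<omega>' k"
    have "shifted_op \<mu> \<phi> \<omega> = shifted_op \<mu> \<phi> \<omega>'" by (rule lead_onlyD[OF assms(3) w(1-3)])
    then have "\<mu> * (\<phi> \<omega> - \<phi> \<omega>') = transfer_op \<phi> \<omega> - transfer_op \<phi> \<omega>'"
      by (simp add: shifted_op_def algebra_simps)
    then have "cmod \<mu> * cmod (\<phi> \<omega> - \<phi> \<omega>') \<le> (wlim + 1) * B"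
      using transfer_op_osc[OF that w] by (simp flip: norm_mult)
    then show "cmod (\<phi> \<omega> - \<phi> \<omega>') \<le> D * B"
      using assms(1) by (simp add: D_def field_simps)
  qed
  have iter: "lead_osc \<phi> 0 (D ^ n * B)" if "lead_osc \<phi> n B" for n B
    using that
  proof (induction n arbitrary: B)
    case (Suc n)
    from Suc.IH[OF step[OF Suc.prems]] show ?case by (simp add: mult_ac)
  qed simp
  \<comment> \<open>Removing \<open>m\<close> coordinates of agreement costs \<open>D ^ m\<close>;
    decay at rate \<open>1 / (2 * D)\<close> leaves \<open>(1/2) ^ m\<close>.\<close>
  obtain K M where KM: "\<And>m. m \<ge> M \<Longrightarrow> lead_osc \<phi> m (K * (1 / (2 * D)) ^ m)"
    using assms(2)[unfolded lead_small_def, rule_format, of "1 / (2 * D)"] D by auto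
  show ?thesis
    unfolding lead_only_def
  proof (intro ballI impI)
    fix \<omega> \<omega>' assume w: "\<omega> \<in> full_shift" "\<omega>' \<in> full_shift" "lead \<omega> = lead \<omega>'"
    have le: "cmod (\<phi> \<omega> - \<phi> \<omega>') \<le> K * (1/2) ^ m" if "m \<ge> M" for m
    proof -
      have "cmod (\<phi> \<omega> - \<phi> \<omega>') \<le> D ^ m * (K * (1 / (2 * D)) ^ m)"
        using iter[OF KM[OF that]] w by (simp add: lead_osc_def)
      also have "\<dots> = K * (D * (1 / (2 * D))) ^ m" unfolding power_mult_distrib by simp
      finally show ?thesis using D by simp
    qed
    have "(\<lambda>m. K * (1/2) ^ m) \<longlonglongrightarrow> K * 0"
      by (intro tendsto_intros LIMSEQ_power_zero) auto
    then have "cmod (\<phi> \<omega> - \<phi> \<omega>') \<le> K * 0"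
      by (rule LIMSEQ_le_const) (use le in blast)
    then show "\<phi> \<omega> = \<phi> \<omega>'" by simp
  qed
qed

text \<open>Starting from the zero function, the property is pulled back through one application of
  \<open>shifted_op\<close> at a time.\<close>

lemma gen_kernel_lead_only:
  assumes "\<mu> \<noteq> 0" "lead_small \<phi>" "(shifted_op \<mu> ^^ n) \<phi> = (\<lambda>_. 0)"
  shows "lead_only \<phi>"
  using assms(2,3)
proof (induction n arbitrary: \<phi>)
  case 0
  then show ?case by (simp add: lead_only_def)
next
  case (Suc n)
  have "(shifted_op \<mu> ^^ n) (shifted_op \<mu> \<phi>) = (\<lambda>_. 0)"
    using Suc.prems(2) by (simp add: funpow_Suc_right del: funpow.simps)
  then have "lead_only (shifted_op \<mu> \<phi>)"
    by (rule Suc.IH[OF lead_small_shifted_op[OF Suc.prems(1)]])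
  then show ?case by (rule lead_only_if_shifted_op[OF assms(1) Suc.prems(1)])
qed

section \<open>Passage from functions to sequences\<close>

lemma lead_only_shifted_op:
  assumes "lead_only \<phi>"
  shows "lead_only (shifted_op \<mu> \<phi>)"
  unfolding lead_only_def
proof (intro ballI impI)
  fix \<omega> \<omega>' assume w: "\<omega> \<in> full_shift" "\<omega>' \<in> full_shift" "lead \<omega> = lead \<omega>'"
  have "\<phi> (case_nat i \<omega>) = \<phi> (case_nat i \<omega>')" if "i = 1 \<or> i = 2" for i
    using w(3) that by (intro lead_onlyD[OF assms] cons_in w) auto
  moreover have "\<phi> \<omega> = \<phi> \<omega>'" by (rule lead_onlyD[OF assms w])
  ultimately show "shifted_op \<mu> \<phi> \<omega> = shifted_op \<mu> \<phi> \<omega>'"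
    unfolding shifted_op_def transfer_op_eq[OF w(1)] transfer_op_eq[OF w(2)] w(3) by simp
qed

text \<open>Prefixing 2 to \<open>block k\<close> gives a word in the class of
  \<open>block 0\<close>, in general a different word; this is where \<open>lead_only\<close>
  enters.\<close>

lemma transfer_op_block:
  assumes "lead_only \<phi>"
  shows "transfer_op \<phi> (block k) = of_real (weight (Suc k)) * \<phi> (block (Suc k)) + \<phi> (block 0)"
proof -
  have "case_nat 1 (block k) = block (Suc k)"
    by (auto simp: block_def fun_eq_iff split: nat.split)
  moreover have "\<phi> (case_nat 2 (block k)) = \<phi> (block 0)"
    by (intro lead_onlyD[OF assms] cons_in) (simp_all add: zero_enat_def)
  ultimately show ?thesis by (simp add: transfer_op_eq del: weight_simps)
qed

lemma transfer_op_ones: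
  assumes "lead_only \<phi>"
  shows "transfer_op \<phi> ones = \<phi> ones + \<phi> (block 0)"
proof -
  have "case_nat 1 ones = ones"
    by (auto simp: ones_def fun_eq_iff split: nat.split)
  moreover have "\<phi> (case_nat 2 ones) = \<phi> (block 0)"
    by (intro lead_onlyD[OF assms] cons_in) (simp_all add: zero_enat_def)
  ultimately show ?thesis by (simp add: transfer_op_eq)
qed

text \<open>The sequence \<open>c\<close> of the overview, with \<open>wprod k\<close> in the role
  of \<open>G\<^sub>k\<close> and \<open>\<phi> (block k)\<close> in that of
  \<open>h\<^sub>k\<close>.\<close>

definition increments :: "(word \<Rightarrow> complex) \<Rightarrow> nat \<Rightarrow> complex" where
  "increments \<phi> k = of_real (wprod k) * \<phi> (block k)
     - (case k of 0 \<Rightarrow> 0 | Suc j \<Rightarrow> of_real (wprod j) * \<phi> (block j))"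

lemma increments_0: "increments \<phi> 0 = \<phi> (block 0)"
  by (simp add: increments_def)

lemma increments_Suc:
  "increments \<phi> (Suc k) = of_real (wprod (Suc k)) * \<phi> (block (Suc k)) - of_real (wprod k) * \<phi> (block k)"
  by (simp add: increments_def)

lemma sum_increments: "(\<Sum>j\<le>k. increments \<phi> j) = of_real (wprod k) * \<phi> (block k)"
  by (induction k) (simp_all add: increments_0 increments_Suc)

text \<open>Multiplying by \<open>wprod k\<close> turns \<open>weight (Suc k)\<close> into
  \<open>wprod (Suc k)\<close>. Taking differences then leaves the next increment plus
  \<open>(wprod k - wprod (k - 1)) * \<phi> (block 0)\<close>, where the bracket is
  \<open>coef (k + 1)\<close>.\<close>

lemma increments_shifted_op:
  assumes "lead_only \<phi>"
  shows "increments (shifted_op \<mu> \<phi>) = (\<lambda>k. seq_op (increments \<phi>) k - \<mu> * increments \<phi> k)"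
proof
  have b: "of_real (wprod k) * shifted_op \<mu> \<phi> (block k)
      = of_real (wprod (Suc k)) * \<phi> (block (Suc k)) + of_real (wprod k) * \<phi> (block 0)
        - \<mu> * (of_real (wprod k) * \<phi> (block k))" for k
    by (simp add: shifted_op_def transfer_op_block[OF assms] algebra_simps)
  show "increments (shifted_op \<mu> \<phi>) k = seq_op (increments \<phi>) k - \<mu> * increments \<phi> k" for k
  proof (cases k)
    case 0
    \<comment> \<open>Nothing is subtracted at index 0: the transfer part is
      \<open>c 1 + 2 * c 0\<close> with \<open>c = increments \<phi>\<close>, in agreement with
      \<open>coef 1 = 2\<close>.\<close>
    have "increments (shifted_op \<mu> \<phi>) 0 = of_real (wprod 0) * shifted_op \<mu> \<phi> (block 0)"
      by (simp add: increments_0)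
    also note b
    finally show ?thesis unfolding 0
      by (simp add: seq_op_def increments_0 increments_Suc coef_def numeral_2_eq_2 algebra_simps)
  next
    case (Suc j)
    show ?thesis
      unfolding Suc increments_Suc[of "shifted_op \<mu> \<phi>"] b
      by (simp add: seq_op_def increments_0 increments_Suc wprod_Suc algebra_simps)
  qed
qed

lemma increments_funpow:
  assumes "lead_only \<phi>"
  shows "increments ((shifted_op \<mu> ^^ n) \<phi>) = ((\<lambda>c k. seq_op c k - \<mu> * c k) ^^ n) (increments \<phi>)"
proof -
  have "lead_only ((shifted_op \<mu> ^^ n) \<phi>)" for n
    by (induction n) (simp_all add: assms lead_only_shifted_op)
  then show ?thesis
    by (induction n) (simp_all add: increments_shifted_op)
qed

lemma Vspace_block:
  assumes "\<phi> \<in> Vspace 2 (\<lambda>_ _. 1)"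
  shows "superexp_small (\<lambda>k. \<phi> (block k) - \<phi> ones)"
proof (rule superexp_small_eventuallyI)
  fix r :: real assume r: "r > 0"
  obtain M where "\<And>m. m \<ge> M \<Longrightarrow> osc_small \<phi> m (r ^ m)" using Vspace_osc[OF assms r] by blast
  moreover have "\<forall>k<m. block m k = ones k" for m by (simp add: block_def ones_def)
  ultimately have "\<forall>k\<ge>M. cmod (\<phi> (block k) - \<phi> ones) \<le> r ^ k"
    using block_in ones_in unfolding osc_small_def by blast
  then show "\<exists>M. \<forall>k\<ge>M. cmod (\<phi> (block k) - \<phi> ones) \<le> r ^ k" by blast
qed

text \<open>Splitting \<open>\<phi> (block k)\<close> into its limit \<open>\<phi> ones\<close> and
  a decaying error, the error contributes decaying terms and the limit contributes a multiple of
  \<open>coef (k + 2)\<close>.\<close>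

lemma superexp_small_increments:
  assumes "\<phi> \<in> Vspace 2 (\<lambda>_ _. 1)"
  shows "superexp_small (increments \<phi>)"
proof (rule superexp_small_SucD)
  let ?d = "\<lambda>k. \<phi> (block k) - \<phi> ones"
  have w: "superexp_small (\<lambda>k. of_real (wprod k) * ?d k)"
  proof (rule superexp_small_bound[OF Vspace_block[OF assms], where B = wlim])
    fix k
    have "\<bar>wprod k\<bar> \<le> wlim" using wprod_ge_1[of k] wprod_le[of k] by simp
    then show "cmod (of_real (wprod k) * ?d k) \<le> wlim * cmod (?d k)"
      by (simp add: norm_mult mult_right_mono)
  qed
  have "superexp_small (\<lambda>k. of_real (wprod (Suc k)) * ?d (Suc k) - of_real (wprod k) * ?d k
      + \<phi> ones * of_real (coef (Suc (Suc k))))"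
    using superexp_small_Suc[OF w]
    by (intro superexp_small_add superexp_small_diff superexp_small_cmult w
        superexp_small_Suc superexp_small_coef)
  then show "superexp_small (\<lambda>k. increments \<phi> (Suc k))"
    by (simp add: increments_Suc wprod_Suc algebra_simps)
qed

text \<open>Partial sums of the increments recover the values on blocks, a limit gives the value on
  \<open>ones\<close>, and \<open>lead_only\<close> carries these to all words.\<close>

lemma increments_inject:
  assumes "lead_only \<phi>" "lead_only \<psi>" "increments \<phi> = increments \<psi>"
    and "(\<lambda>k. \<phi> (block k)) \<longlonglongrightarrow> \<phi> ones" "(\<lambda>k. \<psi> (block k)) \<longlonglongrightarrow> \<psi> ones"
    and "\<And>\<omega>. \<omega> \<notin> full_shift \<Longrightarrow> \<phi> \<omega> = 0" "\<And>\<omega>. \<omega> \<notin> full_shift \<Longrightarrow> \<psi> \<omega> = 0"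
  shows "\<phi> = \<psi>"
proof
  have "of_real (wprod k) * \<phi> (block k) = of_real (wprod k) * \<psi> (block k)" for k
    using assms(3) by (metis sum_increments)
  then have b: "\<phi> (block k) = \<psi> (block k)" for k by simp
  then have o: "\<phi> ones = \<psi> ones"
    using assms(4,5) by (simp add: LIMSEQ_unique)
  show "\<phi> \<omega> = \<psi> \<omega>" for \<omega>
  proof (cases "\<omega> \<in> full_shift")
    case True
    show ?thesis
    proof (cases "lead \<omega>")
      case (enat k)
      then have "\<phi> \<omega> = \<phi> (block k)" "\<psi> \<omega> = \<psi> (block k)"
        using True by (auto intro: lead_onlyD[OF assms(1)] lead_onlyD[OF assms(2)])
      then show ?thesis using b by simp
    next
      case infinity
      then have "\<phi> \<omega> = \<phi> ones" "\<psi> \<omega> = \<psi> ones"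
        using True by (auto intro: lead_onlyD[OF assms(1)] lead_onlyD[OF assms(2)])
      then show ?thesis using o by simp
    qed
  qed (simp add: assms)
qed

section \<open>Eigenfunctions\<close>

text \<open>Inverts \<open>increments\<close> on \<open>seq_eigvec \<mu>\<close>: partial sums
  divided by \<open>wprod\<close>, with their limit at the all-ones word.\<close>

definition eigfun :: "complex \<Rightarrow> word \<Rightarrow> complex" where
  "eigfun \<mu> = of_lead (\<lambda>k. (\<Sum>j\<le>k. seq_eigvec \<mu> j) / of_real (wprod k))
     ((\<Sum>j. seq_eigvec \<mu> j) / of_real wlim)"

lemma eigfun_Vspace:
  assumes "\<mu> \<noteq> 0" "exp (2 / \<mu>) = 2"
  shows "eigfun \<mu> \<in> Vspace 2 (\<lambda>_ _. 1)"
  unfolding eigfun_def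
proof (rule of_lead_Vspace)
  let ?b = "\<lambda>k. \<Sum>j\<le>k. seq_eigvec \<mu> j" and ?l = "\<Sum>j. seq_eigvec \<mu> j"
  note small = superexp_small_eigvec[OF assms]
  have "superexp_small (\<lambda>k. ?b k - ?l)"
  proof (rule superexp_small_tail)
    show "superexp_small (\<lambda>k. ?b (Suc k) - ?b k)"
      using superexp_small_Suc[OF small] by simp
    show "?b \<longlonglongrightarrow> ?l"
      using summable_LIMSEQ'[OF superexp_small_summable[OF small]] .
  qed
  then have 1: "superexp_small (\<lambda>k. (?b k - ?l) / of_real (wprod k))"
  proof (rule superexp_small_bound[where B = 1])
    fix k
    have "cmod (?b k - ?l) / wprod k \<le> cmod (?b k - ?l) / 1"
      using wprod_ge_1[of k] by (intro divide_left_mono) auto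
    then show "cmod ((?b k - ?l) / of_real (wprod k)) \<le> 1 * cmod (?b k - ?l)"
      using wprod_ge_1[of k] by (simp add: norm_divide)
  qed
  have 2: "superexp_small (\<lambda>k. (of_real (wprod k) - of_real wlim) / (of_real (wprod k) * of_real wlim))"
  proof (rule superexp_small_bound[OF superexp_small_wprod, where B = 1])
    fix k
    let ?d = "complex_of_real (wprod k) - of_real wlim"
    have "1 * 1 \<le> wprod k * wlim"
      using wprod_ge_1[of k] wlim_ge_1 by (intro mult_mono) auto
    then have "cmod ?d / (wprod k * wlim) \<le> cmod ?d / 1"
      by (intro divide_left_mono) auto
    then show "cmod (?d / (of_real (wprod k) * of_real wlim)) \<le> 1 * cmod ?d"
      using wprod_ge_1[of k] wlim_ge_1 by (simp add: norm_divide norm_mult)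
  qed
  \<comment> \<open>The error of a quotient is split into the error of its numerator and that of its
    denominator.\<close>
  have "superexp_small (\<lambda>k. (?b k - ?l) / of_real (wprod k)
      - ?l * ((of_real (wprod k) - of_real wlim) / (of_real (wprod k) * of_real wlim)))"
    by (intro superexp_small_diff superexp_small_cmult 1 2)
  moreover have "(?b k - ?l) / of_real (wprod k)
      - ?l * ((of_real (wprod k) - of_real wlim) / (of_real (wprod k) * of_real wlim))
      = ?b k / of_real (wprod k) - ?l / of_real wlim" for k
    using wlim_ge_1 by (simp add: field_simps)
  ultimately show "superexp_small (\<lambda>k. ?b k / of_real (wprod k) - ?l / of_real wlim)"
    by simp
qed

lemma eigfun_lead_only: "lead_only (eigfun \<mu>)"
  by (simp add: lead_only_def eigfun_def of_lead_def)

lemma increments_eigfun: "increments (eigfun \<mu>) = seq_eigvec \<mu>"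
proof
  have b: "of_real (wprod k) * eigfun \<mu> (block k) = (\<Sum>j\<le>k. seq_eigvec \<mu> j)" for k
    by (simp add: eigfun_def of_lead_def)
  show "increments (eigfun \<mu>) k = seq_eigvec \<mu> k" for k
    unfolding increments_def b by (cases k) simp_all
qed

lemma weight_lim: "weight \<longlonglongrightarrow> 1"
proof -
  have "(\<lambda>k. wprod (Suc k) / wprod k) \<longlonglongrightarrow> wlim / wlim"
    using wlim_ge_1 by (intro tendsto_divide LIMSEQ_Suc wprod_lim) auto
  then have "(\<lambda>k. weight (Suc k)) \<longlonglongrightarrow> 1" using wlim_ge_1 by simp
  then show ?thesis by (rule LIMSEQ_imp_Suc)
qed

text \<open>Increments determine a function only through its limit at \<open>ones\<close>. That
  limit is compatible with the operator because the weights tend to 1, their value at the all-ones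
  word.\<close>

lemma transfer_op_eigfun:
  assumes "\<mu> \<noteq> 0" "exp (2 / \<mu>) = 2"
  shows "shifted_op \<mu> (eigfun \<mu>) = (\<lambda>_. 0)"
proof (rule increments_inject)
  let ?\<phi> = "eigfun \<mu>" and ?\<psi> = "shifted_op \<mu> (eigfun \<mu>)"
  show lo: "lead_only ?\<psi>" by (rule lead_only_shifted_op[OF eigfun_lead_only])
  show "lead_only (\<lambda>_. 0)" by (simp add: lead_only_def)
  show "increments ?\<psi> = increments (\<lambda>_. 0)"
    unfolding increments_shifted_op[OF eigfun_lead_only] increments_eigfun
    using assms(1) by (auto simp: seq_op_eigvec increments_def split: nat.split)
  have \<phi>: "(\<lambda>k. ?\<phi> (block k)) \<longlonglongrightarrow> ?\<phi> ones"
    by (rule superexp_small_LIMSEQ[OF Vspace_block[OF eigfun_Vspace[OF assms]]])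
  have "(\<lambda>k. complex_of_real (weight (Suc k)) * ?\<phi> (block (Suc k)) + ?\<phi> (block 0) - \<mu> * ?\<phi> (block k))
      \<longlonglongrightarrow> complex_of_real 1 * ?\<phi> ones + ?\<phi> (block 0) - \<mu> * ?\<phi> ones"
    by (intro tendsto_intros LIMSEQ_Suc[OF \<phi>] LIMSEQ_Suc[OF weight_lim] \<phi>)
  then show "(\<lambda>k. ?\<psi> (block k)) \<longlonglongrightarrow> ?\<psi> ones"
    by (simp add: shifted_op_def transfer_op_block transfer_op_ones eigfun_lead_only
        del: weight_simps)
  show "?\<psi> \<omega> = 0" if "\<omega> \<notin> full_shift" for \<omega>
    using that by (simp add: shifted_op_def transfer_op_def transfer_def eigfun_def of_lead_def
        full_shift_def)
qed auto

section \<open>Generalized eigenspaces and algebraic multiplicities\<close>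

lemma gen_eigenspace_iff:
  "\<phi> \<in> gen_eigenspace 2 (\<lambda>_ _. 1) potential \<mu> \<longleftrightarrow>
   \<phi> \<in> Vspace 2 (\<lambda>_ _. 1) \<and> (\<exists>n. (shifted_op \<mu> ^^ n) \<phi> = (\<lambda>_. 0))"
  by (simp add: gen_eigenspace_def shifted_op_def[abs_def] transfer_op_def)

lemma eigfun_in_gen_eigenspace:
  assumes "\<mu> \<noteq> 0" "exp (2 / \<mu>) = 2"
  shows "eigfun \<mu> \<in> gen_eigenspace 2 (\<lambda>_ _. 1) potential \<mu>"
proof -
  have "(shifted_op \<mu> ^^ 1) (eigfun \<mu>) = (\<lambda>_. 0)"
    using transfer_op_eigfun[OF assms] by simp
  then show ?thesis using eigfun_Vspace[OF assms] unfolding gen_eigenspace_iff by blast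
qed

lemma eigfun_nonzero: "eigfun \<mu> \<noteq> (\<lambda>_. 0)"
  using increments_eigfun[of \<mu>] seq_eigvec_0[of \<mu>] by (auto simp: increments_0 dest: fun_cong[of _ _ 0])

text \<open>\<open>increments\<close> intertwines \<open>shifted_op\<close> with its sequence
  counterpart, so the absence of Jordan chains there makes \<open>increments \<phi>\<close> a
  multiple of \<open>seq_eigvec \<mu>\<close>; injectivity lifts this back to
  \<open>\<phi>\<close>.\<close>

lemma gen_eigenspace_cases:
  assumes "\<mu> \<noteq> 0" "\<phi> \<in> gen_eigenspace 2 (\<lambda>_ _. 1) potential \<mu>"
  obtains "\<phi> = (\<lambda>_. 0)" | a where "exp (2 / \<mu>) = 2" "\<phi> = (\<lambda>\<omega>. a * eigfun \<mu> \<omega>)"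
proof -
  obtain n where V: "\<phi> \<in> Vspace 2 (\<lambda>_ _. 1)" and n: "(shifted_op \<mu> ^^ n) \<phi> = (\<lambda>_. 0)"
    using assms(2) unfolding gen_eigenspace_iff by blast
  have lo: "lead_only \<phi>" by (rule gen_kernel_lead_only[OF assms(1) Vspace_lead_small[OF V] n])
  define c where "c = increments \<phi>"
  have c: "superexp_small c" unfolding c_def by (rule superexp_small_increments[OF V])
  have "((\<lambda>c k. seq_op c k - \<mu> * c k) ^^ n) c = increments (\<lambda>_. 0)"
    unfolding c_def increments_funpow[OF lo, symmetric] n ..
  also have "\<dots> = (\<lambda>_. 0)" by (auto simp: increments_def split: nat.split)
  finally have "\<forall>k. seq_op c k = \<mu> * c k" by (rule seq_op_gen_kernel[OF assms(1) c])
  then have ker: "c = (\<lambda>k. c 0 * seq_eigvec \<mu> k)" "c 0 \<noteq> 0 \<Longrightarrow> exp (2 / \<mu>) = 2"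
    using seq_op_kernel[OF assms(1) c] by blast+
  have lim: "(\<lambda>k. \<phi> (block k)) \<longlonglongrightarrow> \<phi> ones"
    by (rule superexp_small_LIMSEQ[OF Vspace_block[OF V]])
  have off: "\<phi> \<omega> = 0" if "\<omega> \<notin> full_shift" for \<omega>
    using V that by (simp add: Vspace_def full_shift_def)
  have scaled: "increments (\<lambda>\<omega>. c 0 * eigfun \<mu> \<omega>) = c"
  proof -
    have "increments (\<lambda>\<omega>. c 0 * eigfun \<mu> \<omega>) k = c 0 * increments (eigfun \<mu>) k" for k
      by (cases k) (simp_all add: increments_0 increments_Suc algebra_simps)
    then show ?thesis
      unfolding increments_eigfun by (intro ext) (simp add: fun_cong[OF ker(1), symmetric])
  qed
  show thesis
  proof (cases "c 0 = 0")
    case True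
    have "\<phi> = (\<lambda>_. 0)"
    proof (rule increments_inject[OF lo _ _ lim _ off])
      show "increments \<phi> = increments (\<lambda>_. 0)"
        using scaled unfolding True by (simp add: c_def)
    qed (simp_all add: lead_only_def)
    then show thesis by (rule that(1))
  next
    case False
    then have ex: "exp (2 / \<mu>) = 2" by (rule ker(2))
    have "\<phi> = (\<lambda>\<omega>. c 0 * eigfun \<mu> \<omega>)"
    proof (rule increments_inject[OF lo _ _ lim _ off])
      show "lead_only (\<lambda>\<omega>. c 0 * eigfun \<mu> \<omega>)"
        unfolding lead_only_def
        by (intro ballI impI arg_cong[where f = "(*) (c 0)"] lead_onlyD[OF eigfun_lead_only])
      show "increments \<phi> = increments (\<lambda>\<omega>. c 0 * eigfun \<mu> \<omega>)"
        unfolding scaled by (simp only: c_def)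
      show "(\<lambda>k. c 0 * eigfun \<mu> (block k)) \<longlonglongrightarrow> c 0 * eigfun \<mu> ones"
        by (intro tendsto_mult_left
            superexp_small_LIMSEQ[OF Vspace_block[OF eigfun_Vspace[OF assms(1) ex]]])
    qed (simp_all add: eigfun_def of_lead_def)
    with ex show thesis by (rule that(2))
  qed
qed

lemma lin_indep_C_zero: "lin_indep_C S \<Longrightarrow> (\<lambda>_. 0) \<notin> S"
proof
  assume S: "lin_indep_C S" "(\<lambda>_. 0) \<in> S"
  define c :: "(word \<Rightarrow> complex) \<Rightarrow> complex" where "c s = (if s = (\<lambda>_. 0) then 1 else 0)" for s
  have "(\<lambda>\<omega>. \<Sum>s\<in>S. c s * s \<omega>) = (\<lambda>_. 0)"
    by (rule ext, rule sum.neutral) (simp add: c_def)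
  then have "c (\<lambda>_. 0) = 0" using S unfolding lin_indep_C_def by blast
  then show False by (simp add: c_def)
qed

lemma lin_indep_C_multiples:
  assumes S: "lin_indep_C S" and multiples: "\<And>s. s \<in> S \<Longrightarrow> \<exists>a. s = (\<lambda>\<omega>. a * e \<omega>)"
  shows "card S \<le> 1"
proof -
  have fin: "finite S" using S by (simp add: lin_indep_C_def)
  have "s = t" if st: "s \<in> S" "t \<in> S" for s t
  proof (rule ccontr)
    assume ne: "s \<noteq> t"
    obtain a b where ab: "s = (\<lambda>\<omega>. a * e \<omega>)" "t = (\<lambda>\<omega>. b * e \<omega>)" using multiples st by metis
    \<comment> \<open>Encodes the relation \<open>b * s - a * t = 0\<close> between two multiples of
      \<open>e\<close>; independence then gives \<open>b = 0\<close>, hence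
      \<open>t = 0\<close>.\<close>
    define c where "c x = (if x = s then b else if x = t then - a else 0)" for x
    have "(\<Sum>x\<in>S. c x * x \<omega>) = 0" for \<omega>
    proof -
      have "(\<Sum>x\<in>S. c x * x \<omega>) = (\<Sum>x\<in>{s, t}. c x * x \<omega>)"
        using st fin by (intro sum.mono_neutral_right) (auto simp: c_def)
      also have "\<dots> = c s * s \<omega> + c t * t \<omega>" using ne by simp
      also have "\<dots> = b * s \<omega> - a * t \<omega>" using ne by (simp add: c_def)
      also have "\<dots> = 0" by (simp add: ab)
      finally show ?thesis .
    qed
    then have "(\<lambda>\<omega>. \<Sum>x\<in>S. c x * x \<omega>) = (\<lambda>_. 0)" by blast
    then have "\<forall>x\<in>S. c x = 0" using S unfolding lin_indep_C_def by blast
    then have "c s = 0" using st by blast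
    then have "t = (\<lambda>_. 0)" by (simp add: c_def ab)
    then show False using lin_indep_C_zero[OF S] st by blast
  qed
  then show ?thesis unfolding One_nat_def card_le_Suc0_iff_eq[OF fin] by blast
qed

lemma alg_mult_potential:
  assumes "\<mu> \<noteq> 0"
  shows "alg_mult 2 (\<lambda>_ _. 1) potential \<mu> = (if exp (2 / \<mu>) = 2 then 1 else 0)"
proof (rule antisym)
  let ?G = "gen_eigenspace 2 (\<lambda>_ _. 1) potential \<mu>"
  show "alg_mult 2 (\<lambda>_ _. 1) potential \<mu> \<le> (if exp (2 / \<mu>) = 2 then 1 else 0)"
    unfolding alg_mult_def
  proof (rule SUP_least)
    fix S assume "S \<in> {S. S \<subseteq> ?G \<and> lin_indep_C S}"
    then have sub: "S \<subseteq> ?G" and S: "lin_indep_C S" by auto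
    show "enat (card S) \<le> (if exp (2 / \<mu>) = 2 then 1 else 0)"
    proof (cases "exp (2 / \<mu>) = 2")
      case True
      have "\<exists>a. s = (\<lambda>\<omega>. a * eigfun \<mu> \<omega>)" if "s \<in> S" for s
      proof -
        have "s \<in> ?G" using that sub by blast
        then show ?thesis
        proof (rule gen_eigenspace_cases[OF assms])
          assume "s = (\<lambda>_. 0)"
          then have "s = (\<lambda>\<omega>. 0 * eigfun \<mu> \<omega>)" by simp
          then show ?thesis ..
        qed blast
      qed
      then have "card S \<le> 1" by (rule lin_indep_C_multiples[OF S])
      then show ?thesis using True by (simp add: one_enat_def)
    next
      case False
      have "s = (\<lambda>_. 0)" if "s \<in> S" for s
      proof -
        have "s \<in> ?G" using that sub by blast
        then show ?thesis by (rule gen_eigenspace_cases[OF assms]) (use False in auto)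
      qed
      then have "S = {}" using lin_indep_C_zero[OF S] by blast
      then show ?thesis using False by (simp add: zero_enat_def)
    qed
  qed
  show "(if exp (2 / \<mu>) = 2 then 1 else 0) \<le> alg_mult 2 (\<lambda>_ _. 1) potential \<mu>"
  proof (cases "exp (2 / \<mu>) = 2")
    case True
    have "lin_indep_C {eigfun \<mu>}"
    proof -
      obtain \<omega> where "eigfun \<mu> \<omega> \<noteq> 0" using eigfun_nonzero[of \<mu>] by blast
      then show ?thesis by (auto simp: lin_indep_C_def dest: fun_cong[of _ _ \<omega>])
    qed
    then have "enat (card {eigfun \<mu>}) \<le> alg_mult 2 (\<lambda>_ _. 1) potential \<mu>"
      unfolding alg_mult_def using eigfun_in_gen_eigenspace[OF assms True]
      by (intro SUP_upper) simp
    then show ?thesis using True by (simp add: one_enat_def)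
  qed simp
qed

section \<open>Enumeration of the eigenvalues and divergence of their sum\<close>

text \<open>The order 0, -1, 1, -2, 2, ... has nondecreasing absolute values, as needed for
  eigenvalues of nonincreasing modulus.\<close>

definition int_enum :: "nat \<Rightarrow> int" where
  "int_enum n = (if even n then int (n div 2) else - int (Suc n div 2))"

lemma int_enum_bij: "bij int_enum"
proof (rule bijI')
  show "int_enum m = int_enum n \<longleftrightarrow> m = n" for m n
    unfolding int_enum_def by (auto elim!: evenE oddE; presburger)
  show "\<exists>n. m = int_enum n" for m
  proof (cases "m \<ge> 0")
    case True
    then have "m = int_enum (2 * nat m)" by (simp add: int_enum_def)
    then show ?thesis ..
  next
    case False
    then have "m = int_enum (2 * nat (- m) - 1)" by (auto simp: int_enum_def)
    then show ?thesis ..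
  qed
qed

lemma abs_int_enum: "\<bar>int_enum n\<bar> = int (Suc n div 2)"
  by (auto simp: int_enum_def elim: evenE)

text \<open>All complex logarithms of 2. They are the values \<open>2 / \<mu>\<close>, twice the
  zeros \<open>1/\<mu>\<close> of \<open>2 - exp (2 z)\<close>.\<close>

definition zeros :: "nat \<Rightarrow> complex" where
  "zeros n = Complex (ln 2) (2 * pi * of_int (int_enum n))"

lemma zeros_nonzero: "zeros n \<noteq> 0"
  by (simp add: zeros_def complex_eq_iff)

lemma inj_zeros: "inj zeros"
  using bij_is_inj[OF int_enum_bij] by (auto simp: zeros_def inj_on_def)

lemma exp_eq_2_iff: "exp w = 2 \<longleftrightarrow> w \<in> range zeros"
proof
  assume w: "exp w = 2"
  have "exp w = exp (complex_of_real (ln 2))" unfolding w exp_of_real by simp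
  then obtain m where "w = complex_of_real (ln 2) + of_real (2 * of_int m * pi) * \<i>"
    unfolding exp_eq by auto
  moreover obtain n where "m = int_enum n" using bij_is_surj[OF int_enum_bij] by blast
  ultimately have "w = zeros n" by (simp add: zeros_def complex_eq_iff)
  then show "w \<in> range zeros" by blast
next
  assume "w \<in> range zeros"
  then obtain n where "w = zeros n" by blast
  then have "w = complex_of_real (ln 2) + of_real (2 * of_int (int_enum n) * pi) * \<i>"
    by (simp add: zeros_def complex_eq_iff)
  then have "exp w = exp (complex_of_real (ln 2))" unfolding exp_eq by auto
  then show "exp w = 2" unfolding exp_of_real by simp
qed

lemma norm_zeros: "cmod (zeros n) = sqrt ((ln 2)\<^sup>2 + (2 * pi * real (Suc n div 2))\<^sup>2)"
proof -
  have "(real_of_int (int_enum n))\<^sup>2 = (real (Suc n div 2))\<^sup>2"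
    using arg_cong[OF abs_int_enum[of n], of real_of_int]
    by (metis of_int_abs of_int_of_nat_eq power2_abs)
  then show ?thesis by (simp add: zeros_def cmod_def power_mult_distrib)
qed

lemma eigen_enumeration_potential:
  "eigen_enumeration 2 (\<lambda>_ _. 1) potential (\<lambda>n. 2 / zeros n)"
  unfolding eigen_enumeration_def
proof (intro conjI allI impI)
  fix n
  have "cmod (zeros n) \<le> cmod (zeros (Suc n))"
    unfolding norm_zeros by (intro real_sqrt_le_mono add_left_mono power_mono mult_left_mono) auto
  then show "cmod (2 / zeros (Suc n)) \<le> cmod (2 / zeros n)"
    using zeros_nonzero by (simp add: norm_divide frac_le)
next
  fix \<mu> :: complex assume \<mu>: "\<mu> \<noteq> 0"
  have eq: "{n. 2 / zeros n = \<mu>} = {n. zeros n = 2 / \<mu>}"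
    using \<mu> zeros_nonzero by (auto simp: field_simps)
  show "(if finite {n. 2 / zeros n = \<mu>} then enat (card {n. 2 / zeros n = \<mu>}) else \<infinity>)
      = alg_mult 2 (\<lambda>_ _. 1) potential \<mu>"
  proof (cases "exp (2 / \<mu>) = 2")
    case True
    then obtain n where n: "2 / \<mu> = zeros n" using exp_eq_2_iff by blast
    have "{m. zeros m = 2 / \<mu>} = {n}" unfolding n using inj_zeros by (auto dest: injD)
    then show ?thesis using True alg_mult_potential[OF \<mu>] by (simp add: eq one_enat_def)
  next
    case False
    then have "zeros m \<noteq> 2 / \<mu>" for m using exp_eq_2_iff by (metis rangeI)
    then have "{m. zeros m = 2 / \<mu>} = {}" by blast
    then show ?thesis using False alg_mult_potential[OF \<mu>] by (simp add: eq zero_enat_def)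
  qed
qed

lemma not_summable_eigenvalues: "\<not> summable (\<lambda>n. cmod (2 / zeros n))"
proof
  assume sum: "summable (\<lambda>n. cmod (2 / zeros n))"
  have le: "cmod (zeros n) \<le> 9 * real (Suc n)" for n
  proof -
    have "cmod (zeros n) \<le> \<bar>ln 2\<bar> + \<bar>2 * pi * real (Suc n div 2)\<bar>"
      unfolding norm_zeros by (rule sqrt_sum_squares_le_sum_abs)
    \<comment> \<open>Crude bounds suffice for comparison with the harmonic series:
      \<open>ln 2 < 1\<close>, \<open>pi < 4\<close>, and halving the index is ignored.\<close>
    also have "\<dots> \<le> 1 + 2 * 4 * real (Suc n)"
    proof -
      have "2 * pi * real (Suc n div 2) \<le> 2 * 4 * real (Suc n)"
        using pi_less_4 by (intro mult_mono) auto
      then show ?thesis using ln_2_less_1 by (simp add: abs_mult)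
    qed
    finally show ?thesis by simp
  qed
  have "2 / 9 * (1 / real (Suc n)) \<le> cmod (2 / zeros n)" for n
    using zeros_nonzero[of n] le[of n] by (simp add: norm_divide divide_simps)
  then have "summable (\<lambda>n. 2 / 9 * (1 / real (Suc n)))"
    by (intro summable_comparison_test'[OF sum, of 0]) auto
  then have "summable (\<lambda>n. 1 / real (Suc n))" by (subst (asm) summable_cmult_iff) simp
  then have "summable (\<lambda>n. 1 / real n)" by (subst (asm) summable_Suc_iff)
  then show False using not_summable_harmonic[where 'a = real] by (simp add: inverse_eq_divide)
qed

theorem theoremA2:
  fixes N :: nat and A :: "nat \<Rightarrow> nat \<Rightarrow> nat"
  assumes "N = 2" and "\<And>i j. A i j = 1"
  shows "\<exists>f \<in> Vspace N A. (\<forall>\<omega>. Im (f \<omega>) = 0) \<and>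
           (\<exists>lam. eigen_enumeration N A f lam \<and> \<not> summable (\<lambda>n. cmod (lam n)))"
proof -
  have [simp]: "A = (\<lambda>_ _. 1)" using assms(2) by (auto simp: fun_eq_iff)
  have "\<forall>\<omega>. Im (potential \<omega>) = 0" by (auto simp: potential_def of_lead_def split: enat.split)
  then show ?thesis
    unfolding \<open>A = (\<lambda>_ _. 1)\<close> \<open>N = 2\<close>
    using potential_Vspace eigen_enumeration_potential not_summable_eigenvalues by blast
qed

end
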